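(* Let $\varphi,\psi\in L^1_\alpha(\mathbb R^{d+1}_+)\cap L^\infty_\alpha(\mathbb R^{d+1}_+)$. Then for all $\sigma\in L^1_\alpha(\mathcal X)$ and all $1\le p\le\infty$, with $\frac1p+\frac1q=1$, there exists a unique bounded linear operator $\mathcal L_{\varphi,\psi}(\sigma)$ from $L^p_\alpha(\mathbb R^{d+1}_+)$ into itself (given by the defining formula of the two-wavelet localization operator), and $$\|\mathcal L_{\varphi,\psi}(\sigma)\|_{\mathcal B(L^p_\alpha(\mathbb R^{d+1}_+))}\le \|\varphi\|_{\alpha,1}^{\frac1q}\,\|\psi\|_{\alpha,1}^{\frac1p}\,\|\varphi\|_{\alpha,\infty}^{\frac1p}\,\|\psi\|_{\alpha,\infty}^{\frac1q}\,\|\sigma\|_{L^1_\alpha(\mathcal X)}.$$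
   Context: Fix an integer $d\ge 1$ and a real $\alpha>-1/2$. Let $\mathbb R^{d+1}_+=\mathbb R^d\times(0,\infty)$, with points $x=(x',x_{d+1})$, equipped with the measure $$d\mu_\alpha(x)=\frac{x_{d+1}^{2\alpha+1}}{(2\pi)^d2^{2\alpha}\Gamma^2(\alpha+1)}\,dx.$$ For $1\le p\le\infty$, $L^p_\alpha(\mathbb R^{d+1}_+)$ is the $L^p$ space of complex-valued functions for $\mu_\alpha$, with norm $\|\cdot\|_{\alpha,p}$; $\mathcal B(E)$ denotes the bounded linear operators on a Banach space $E$ and $\|\cdot\|_{\mathcal B(E)}$ the operator norm. Convention: $1/\infty=0$. Let $\mathcal X=\{(a,x): a>0,\ x\in\mathbb R^{d+1}_+\}$ with measure $d\mu_\alpha(a,x)=\frac{d\mu_\alpha(x)\,da}{a^{2\alpha+d+3}}$, and $L^p_\alpha(\mathcal X)$ the corresponding $L^p$ space with norm $\|\cdot\|_{L^p_\alpha(\mathcal X)}$. Generalized translation, for $x,y\in\mathbb R^{d+1}_+$: $$\tau^\alpha_x\varphi(y)=\frac{\Gamma(\alpha+1)}{\sqrt\pi\,\Gamma(\alpha+1/2)}\int_0^\pi\varphi\Big(x'+y',\sqrt{x_{d+1}^2+y_{d+1}^2+2x_{d+1}y_{d+1}\cos\theta}\Big)(\sin\theta)^{2\alpha}\,d\theta;$$ it extends to a contraction on every $L^p_\alpha(\mathbb R^{d+1}_+)$. For $a>0$ put $\varphi_a(x)=a^{-(2\alpha+d+2)}\varphi(x/a)$ and $\varphi_{a,x}(y)=a^{\alpha+1+\frac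 d2}\,\tau^\alpha_x\varphi_a(y)$. Weinstein continuous wavelet transform (for $f$ and $\varphi$ in Lebesgue spaces with conjugate exponents): $$\Phi^W_\varphi(f)(a,x)=\int_{\mathbb R^{d+1}_+}f(y)\,\overline{\varphi_{a,x}(y)}\,d\mu_\alpha(y),\quad (a,x)\in\mathcal X.$$ Two-wavelet localization operator with symbol $\sigma$ (measurable on $\mathcal X$) and windows $\varphi,\psi$ (measurable on $\mathbb R^{d+1}_+$): $$\mathcal L_{\varphi,\psi}(\sigma)(f)(y)=\int_{\mathcal X}\sigma(a,x)\,\Phi^W_\varphi(f)(a,x)\,\psi_{a,x}(y)\,d\mu_\alpha(a,x),\quad y\in\mathbb R^{d+1}_+.$$ *)

theory Defs
  imports "HOL-Analysis.Analysis" "HOL-Probability.Essential_Supremum"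
begin

section \<open>Complex Lebesgue spaces\<close>

definition Lp_functions :: "'a measure \<Rightarrow> ennreal \<Rightarrow> ('a \<Rightarrow> complex) set" where
  "Lp_functions M p = {f \<in> borel_measurable M.
     if p = \<infinity> then esssup M (\<lambda>x. ereal (norm (f x))) < \<infinity>
     else integrable M (\<lambda>x. norm (f x) powr enn2real p)}"

definition Lp_norm :: "'a measure \<Rightarrow> ennreal \<Rightarrow> ('a \<Rightarrow> complex) \<Rightarrow> real" where
  "Lp_norm M p f =
     (if p = \<infinity> then real_of_ereal (esssup M (\<lambda>x. ereal (norm (f x))))
      else (LINT x|M. norm (f x) powr enn2real p) powr (1 / enn2real p))"

text \<open>
  The Banach space itself is the quotient of the function space by equality almost everywhere.
  The operations and the norm on classes are the ones induced by representatives.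
\<close>

definition ae_rel :: "'a measure \<Rightarrow> ennreal \<Rightarrow> (('a \<Rightarrow> complex) \<times> ('a \<Rightarrow> complex)) set" where
  "ae_rel M p = {(f, g). f \<in> Lp_functions M p \<and> g \<in> Lp_functions M p \<and> (AE x in M. f x = g x)}"

definition Lp_class :: "'a measure \<Rightarrow> ennreal \<Rightarrow> ('a \<Rightarrow> complex) \<Rightarrow> ('a \<Rightarrow> complex) set" where
  "Lp_class M p f = ae_rel M p `` {f}"

definition Lp_space :: "'a measure \<Rightarrow> ennreal \<Rightarrow> ('a \<Rightarrow> complex) set set" where
  "Lp_space M p = Lp_functions M p // ae_rel M p"

definition Lp_add ::
  "'a measure \<Rightarrow> ennreal \<Rightarrow> ('a \<Rightarrow> complex) set \<Rightarrow> ('a \<Rightarrow> complex) set \<Rightarrow> ('a \<Rightarrow> complex) set" where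
  "Lp_add M p F G = (\<Union>f\<in>F. \<Union>g\<in>G. Lp_class M p (\<lambda>x. f x + g x))"

definition Lp_scale ::
  "'a measure \<Rightarrow> ennreal \<Rightarrow> complex \<Rightarrow> ('a \<Rightarrow> complex) set \<Rightarrow> ('a \<Rightarrow> complex) set" where
  "Lp_scale M p c F = (\<Union>f\<in>F. Lp_class M p (\<lambda>x. c * f x))"

definition Lp_class_norm :: "'a measure \<Rightarrow> ennreal \<Rightarrow> ('a \<Rightarrow> complex) set \<Rightarrow> real" where
  "Lp_class_norm M p F = the_elem (Lp_norm M p ` F)"

text \<open>Operators are taken extensional on the space, so that equality of operators is equality
  of Isabelle functions.\<close>

definition bounded_operator_Lp ::
  "'a measure \<Rightarrow> ennreal \<Rightarrow> (('a \<Rightarrow> complex) set \<Rightarrow> ('a \<Rightarrow> complex) set) \<Rightarrow> bool" where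
  "bounded_operator_Lp M p T \<longleftrightarrow>
     T \<in> Lp_space M p \<rightarrow>\<^sub>E Lp_space M p \<and>
     (\<forall>F\<in>Lp_space M p. \<forall>G\<in>Lp_space M p. T (Lp_add M p F G) = Lp_add M p (T F) (T G)) \<and>
     (\<forall>c. \<forall>F\<in>Lp_space M p. T (Lp_scale M p c F) = Lp_scale M p c (T F)) \<and>
     (\<exists>C. \<forall>F\<in>Lp_space M p. Lp_class_norm M p (T F) \<le> C * Lp_class_norm M p F)"

text \<open>The analogue of \<^const>\<open>onorm\<close>; the zero class contributes \<open>0 / 0 = 0\<close>.\<close>

definition operator_norm_Lp ::
  "'a measure \<Rightarrow> ennreal \<Rightarrow> (('a \<Rightarrow> complex) set \<Rightarrow> ('a \<Rightarrow> complex) set) \<Rightarrow> real" where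
  "operator_norm_Lp M p T = (SUP F\<in>Lp_space M p. Lp_class_norm M p (T F) / Lp_class_norm M p F)"


section \<open>The Weinstein setting\<close>

text \<open>
  Points of $R^{d+1}$ are pairs in \<open>(real ^ 'n) \<times> real\<close> with \<open>d = CARD('n)\<close>; all measures below
  live on the half-space (respectively on its product with the positive reals).
\<close>

definition half_space :: "((real ^ 'n) \<times> real) set" where
  "half_space = {x. 0 < snd x}"

definition weinstein_measure :: "real \<Rightarrow> ((real ^ 'n) \<times> real) measure" where
  "weinstein_measure \<alpha> = density (restrict_space lborel half_space)
     (\<lambda>x. ennreal (snd x powr (2 * \<alpha> + 1) /
        ((2 * pi) ^ CARD('n) * 2 powr (2 * \<alpha>) * (Gamma (\<alpha> + 1))\<^sup>2)))"

definition scale_measure_X :: "real \<Rightarrow> (real \<times> ((real ^ 'n) \<times> real)) measure" where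
  "scale_measure_X \<alpha> = density (restrict_space lborel {0<..} \<Otimes>\<^sub>M weinstein_measure \<alpha>)
     (\<lambda>(a, x). ennreal (1 / a powr (2 * \<alpha> + real CARD('n) + 3)))"

text \<open>
  The open interval keeps the argument of \<open>\<phi>\<close> inside the half-space (at \<open>\<theta> = \<pi>\<close> and
  \<open>snd x = snd y\<close> it would leave it). For \<open>\<phi>\<close> in a Lebesgue space the integral converges for almost
  every \<open>y\<close>, so this formula also gives the extension of the translation to that space.
\<close>

definition translation ::
  "real \<Rightarrow> (real ^ 'n) \<times> real \<Rightarrow> ((real ^ 'n) \<times> real \<Rightarrow> complex) \<Rightarrow> (real ^ 'n) \<times> real \<Rightarrow> complex" where
  "translation \<alpha> x \<phi> y =
     complex_of_real (Gamma (\<alpha> + 1) / (sqrt pi * Gamma (\<alpha> + 1 / 2))) *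
     (LINT \<theta>:{0<..<pi}|lborel.
        \<phi> (fst x + fst y, sqrt ((snd x)\<^sup>2 + (snd y)\<^sup>2 + 2 * snd x * snd y * cos \<theta>)) *
        complex_of_real (sin \<theta> powr (2 * \<alpha>)))"

definition dilation ::
  "real \<Rightarrow> real \<Rightarrow> ((real ^ 'n) \<times> real \<Rightarrow> complex) \<Rightarrow> (real ^ 'n) \<times> real \<Rightarrow> complex" where
  "dilation \<alpha> a \<phi> x =
     complex_of_real (a powr - (2 * \<alpha> + real CARD('n) + 2)) * \<phi> (x /\<^sub>R a)"

definition wavelet_family ::
  "real \<Rightarrow> ((real ^ 'n) \<times> real \<Rightarrow> complex) \<Rightarrow> real \<Rightarrow> (real ^ 'n) \<times> real \<Rightarrow> (real ^ 'n) \<times> real \<Rightarrow> complex" where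
  "wavelet_family \<alpha> \<phi> a x y =
     complex_of_real (a powr (\<alpha> + 1 + real CARD('n) / 2)) * translation \<alpha> x (dilation \<alpha> a \<phi>) y"

definition wavelet_transform ::
  "real \<Rightarrow> ((real ^ 'n) \<times> real \<Rightarrow> complex) \<Rightarrow> ((real ^ 'n) \<times> real \<Rightarrow> complex) \<Rightarrow>
     real \<Rightarrow> (real ^ 'n) \<times> real \<Rightarrow> complex" where
  "wavelet_transform \<alpha> \<phi> f a x =
     (LINT y|weinstein_measure \<alpha>. f y * cnj (wavelet_family \<alpha> \<phi> a x y))"

definition localization_integrand ::
  "real \<Rightarrow> ((real ^ 'n) \<times> real \<Rightarrow> complex) \<Rightarrow> ((real ^ 'n) \<times> real \<Rightarrow> complex) \<Rightarrow>
     (real \<times> ((real ^ 'n) \<times> real) \<Rightarrow> complex) \<Rightarrow> ((real ^ 'n) \<times> real \<Rightarrow> complex) \<Rightarrow>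
     (real ^ 'n) \<times> real \<Rightarrow> real \<times> ((real ^ 'n) \<times> real) \<Rightarrow> complex" where
  "localization_integrand \<alpha> \<phi> \<psi> \<sigma> f y =
     (\<lambda>(a, x). \<sigma> (a, x) * wavelet_transform \<alpha> \<phi> f a x * wavelet_family \<alpha> \<psi> a x y)"

definition localization ::
  "real \<Rightarrow> ((real ^ 'n) \<times> real \<Rightarrow> complex) \<Rightarrow> ((real ^ 'n) \<times> real \<Rightarrow> complex) \<Rightarrow>
     (real \<times> ((real ^ 'n) \<times> real) \<Rightarrow> complex) \<Rightarrow> ((real ^ 'n) \<times> real \<Rightarrow> complex) \<Rightarrow>
     (real ^ 'n) \<times> real \<Rightarrow> complex" where
  "localization \<alpha> \<phi> \<psi> \<sigma> f y =
     (LINT z|scale_measure_X \<alpha>. localization_integrand \<alpha> \<phi> \<psi> \<sigma> f y z)"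

text \<open>
  The Bochner integral is total (it is \<open>0\<close> for non-integrable functions), so that the integrals
  in the two previous definitions converge has to be said separately.
\<close>

definition localization_converges ::
  "real \<Rightarrow> ((real ^ 'n) \<times> real \<Rightarrow> complex) \<Rightarrow> ((real ^ 'n) \<times> real \<Rightarrow> complex) \<Rightarrow>
     (real \<times> ((real ^ 'n) \<times> real) \<Rightarrow> complex) \<Rightarrow> ((real ^ 'n) \<times> real \<Rightarrow> complex) \<Rightarrow> bool" where
  "localization_converges \<alpha> \<phi> \<psi> \<sigma> f \<longleftrightarrow>
     (\<forall>a>0. \<forall>x\<in>half_space.
        integrable (weinstein_measure \<alpha>) (\<lambda>y. f y * cnj (wavelet_family \<alpha> \<phi> a x y))) \<and>
     (AE y in weinstein_measure \<alpha>.
        integrable (scale_measure_X \<alpha>) (localization_integrand \<alpha> \<phi> \<psi> \<sigma> f y))"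

definition is_localization_operator ::
  "real \<Rightarrow> ((real ^ 'n) \<times> real \<Rightarrow> complex) \<Rightarrow> ((real ^ 'n) \<times> real \<Rightarrow> complex) \<Rightarrow>
     (real \<times> ((real ^ 'n) \<times> real) \<Rightarrow> complex) \<Rightarrow> ennreal \<Rightarrow>
     (((real ^ 'n) \<times> real \<Rightarrow> complex) set \<Rightarrow> ((real ^ 'n) \<times> real \<Rightarrow> complex) set) \<Rightarrow> bool" where
  "is_localization_operator \<alpha> \<phi> \<psi> \<sigma> p T \<longleftrightarrow>
     bounded_operator_Lp (weinstein_measure \<alpha>) p T \<and>
     (\<forall>f\<in>Lp_functions (weinstein_measure \<alpha>) p.
        localization_converges \<alpha> \<phi> \<psi> \<sigma> f \<and>
        T (Lp_class (weinstein_measure \<alpha>) p f) =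
          Lp_class (weinstein_measure \<alpha>) p (localization \<alpha> \<phi> \<psi> \<sigma> f))"

end

theory Submission
  imports Defs "HOL-Real_Asymp.Real_Asymp"
begin

text \<open>
  The localization operator is an integral over the parameters \<open>z = (a, x)\<close> of the rank-one operators
  \<open>f \<mapsto> \<langle>f, \<phi>\<^sub>z\<rangle> \<psi>\<^sub>z\<close> with density \<open>\<sigma> z\<close>. So it is dominated by the operator with the positive kernel
  \<open>K (y, w) = \<integral> \<bar>\<sigma> z\<bar> \<bar>\<phi>\<^sub>z w\<bar> \<bar>\<psi>\<^sub>z y\<bar> dz\<close>, and Schur's test bounds it on \<open>Lp\<close> by
  \<open>A powr (1 / q) * B powr (1 / p)\<close>, where \<open>A\<close> bounds the integral of \<open>K\<close> over \<open>w\<close> and \<open>B\<close> the integral over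
  \<open>y\<close>. With \<open>k = \<alpha> + 1 + d / 2\<close>, every wavelet satisfies
  \<open>\<parallel>\<phi>\<^sub>z\<parallel>\<^sub>1 \<le> a powr k * \<parallel>\<phi>\<parallel>\<^sub>1\<close> and \<open>\<parallel>\<phi>\<^sub>z\<parallel>\<^sub>\<infinity> \<le> a powr - k * \<parallel>\<phi>\<parallel>\<^sub>\<infinity>\<close>. In \<open>A\<close> and in \<open>B\<close> an \<open>L1\<close> norm of one
  wavelet multiplies a supremum of the other, so the powers of \<open>a\<close> cancel, and
  \<open>A = \<parallel>\<phi>\<parallel>\<^sub>1 \<parallel>\<psi>\<parallel>\<^sub>\<infinity> \<parallel>\<sigma>\<parallel>\<^sub>1\<close>, \<open>B = \<parallel>\<phi>\<parallel>\<^sub>\<infinity> \<parallel>\<psi>\<parallel>\<^sub>1 \<parallel>\<sigma>\<parallel>\<^sub>1\<close>, which is the asserted bound, for all \<open>p\<close> at once. This part holds for any pair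
  of jointly measurable kernels with such norm bounds, and it is carried out in the locale
  \<open>balanced_kernels\<close>, with result \<open>superposition_operator\<close>.

  The two norm bounds rest on the fact that the generalized translation preserves the Weinstein
  integral of nonnegative Borel functions (\<open>nn_integral_translated_point\<close>). This gives the \<open>L1\<close> bound, and,
  applied to the indicator of a null set, it shows that a bound that holds almost everywhere survives the
  translation. In the last coordinate the translation is an average over \<open>\<theta>\<close>; read in polar
  coordinates \<open>(s cos \<theta>, s sin \<theta>)\<close>, the measure
  \<open>s powr (2 * \<alpha> + 1) * sin \<theta> powr (2 * \<alpha>) ds d\<theta>\<close> is \<open>b powr (2 * \<alpha>) da db\<close> on the upper half-plane, and the
  argument of the function is the distance of \<open>(a, b)\<close> to \<open>(- r, 0)\<close>, so the claim is the
  invariance of \<open>b powr (2 * \<alpha>) da db\<close> under horizontal shifts (\<open>nn_integral_Bessel_translation\<close>). The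
  normalizing constant is then a Beta integral, evaluated by the duplication formula.

  Uniqueness is immediate: the formula prescribes the operator on the class of every function.
\<close>

section \<open>Lebesgue classes and operators on them\<close>

lemma Lp_functions_measurable:
  "f \<in> Lp_functions M p \<Longrightarrow> f \<in> borel_measurable M"
  by (simp add: Lp_functions_def)

lemma Lp_functions_finite_iff:
  assumes "p \<noteq> \<infinity>"
  shows "f \<in> Lp_functions M p \<longleftrightarrow>
    f \<in> borel_measurable M \<and> integrable M (\<lambda>x. norm (f x) powr enn2real p)"
  using assms by (simp add: Lp_functions_def)

lemma Lp_functions_infinityI:
  assumes "f \<in> borel_measurable M" "AE x in M. norm (f x) \<le> C"
  shows "f \<in> Lp_functions M \<infinity>"
proof -
  have "esssup M (\<lambda>x. ereal (norm (f x))) \<le> ereal C"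
    using assms by (intro esssup_I) auto
  then show ?thesis
    using assms by (auto simp: Lp_functions_def intro: order_le_less_trans)
qed

lemma Lp_norm_nonneg: "0 \<le> Lp_norm M p f"
proof (cases "p = \<infinity>")
  case True
  let ?e = "esssup M (\<lambda>x. ereal (norm (f x)))"
  have "0 \<le> real_of_ereal ?e"
  proof (cases "(\<lambda>x. ereal (norm (f x))) \<in> borel_measurable M \<and> ?e < 0")
    case True
    \<comment> \<open>A negative essential supremum of a nonnegative function means that the space is null;
       then the essential supremum is \<open>-\<infinity>\<close>, which is sent to \<open>0\<close>.\<close>
    have "AE x in M. ereal (norm (f x)) \<le> ?e"
      by (rule esssup_AE)
    then have "AE x in M. ereal (norm (f x)) \<le> -\<infinity>"
      using True by (auto elim!: eventually_mono dest: order_le_less_trans)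
    then have "?e \<le> -\<infinity>"
      using True by (intro esssup_I) auto
    then show ?thesis by simp
  next
    case False
    then show ?thesis
      using esssup_non_measurable[of "\<lambda>x. ereal (norm (f x))" M]
      by (auto simp: not_less real_of_ereal_pos top_ereal_def)
  qed
  then show ?thesis by (simp add: Lp_norm_def True)
qed (simp add: Lp_norm_def)

lemma Lp_norm_infinity_AE:
  assumes "f \<in> Lp_functions M \<infinity>"
  shows "AE x in M. norm (f x) \<le> Lp_norm M \<infinity> f"
proof -
  have "esssup M (\<lambda>x. ereal (norm (f x))) < \<infinity>"
    using assms by (simp add: Lp_functions_def)
  then show ?thesis
    using esssup_AE[of "\<lambda>x. ereal (norm (f x))" M]
    by (cases "esssup M (\<lambda>x. ereal (norm (f x)))") (auto simp: Lp_norm_def elim: eventually_mono)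
qed

lemma Lp_norm_infinity_le:
  assumes "f \<in> borel_measurable M" "AE x in M. norm (f x) \<le> C" "0 \<le> C"
  shows "Lp_norm M \<infinity> f \<le> C"
proof -
  have "esssup M (\<lambda>x. ereal (norm (f x))) \<le> ereal C"
    using assms by (intro esssup_I) auto
  then show ?thesis
    using \<open>0 \<le> C\<close> by (cases "esssup M (\<lambda>x. ereal (norm (f x)))") (auto simp: Lp_norm_def)
qed

lemma Lp_norm_1: "Lp_norm M 1 f = (LINT x|M. norm (f x))"
  by (simp add: Lp_norm_def)

lemma Lp_functions_1_iff:
  "f \<in> Lp_functions M 1 \<longleftrightarrow> integrable M f"
  by (auto simp: Lp_functions_def integrable_norm_iff)

lemma Lp_norm_AE_cong:
  assumes "f \<in> borel_measurable M" "g \<in> borel_measurable M" "AE x in M. f x = g x"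
  shows "Lp_norm M p f = Lp_norm M p g"
proof -
  have "esssup M (\<lambda>x. ereal (norm (f x))) = esssup M (\<lambda>x. ereal (norm (g x)))"
    using assms by (intro esssup_AE_cong) auto
  moreover have "(LINT x|M. norm (f x) powr enn2real p) = (LINT x|M. norm (g x) powr enn2real p)"
    using assms by (intro integral_cong_AE) auto
  ultimately show ?thesis
    by (simp add: Lp_norm_def)
qed

lemma norm_add_powr_le:
  fixes a b :: complex
  assumes "0 \<le> r"
  shows "norm (a + b) powr r \<le> 2 powr r * (norm a powr r + norm b powr r)"
proof -
  have "norm (a + b) \<le> 2 * max (norm a) (norm b)"
    using norm_triangle_ineq[of a b] by linarith
  then have "norm (a + b) powr r \<le> 2 powr r * max (norm a) (norm b) powr r"
    using assms by (metis norm_ge_zero powr_mono2 powr_mult)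
  also have "max (norm a) (norm b) powr r \<le> norm a powr r + norm b powr r"
    by (auto simp: max_def)
  finally show ?thesis by simp
qed

lemma Lp_functions_add:
  assumes f: "f \<in> Lp_functions M p" and g: "g \<in> Lp_functions M p"
  shows "(\<lambda>x. f x + g x) \<in> Lp_functions M p"
proof (cases "p = \<infinity>")
  case True
  show ?thesis unfolding True
  proof (rule Lp_functions_infinityI)
    show "(\<lambda>x. f x + g x) \<in> borel_measurable M"
      by (rule borel_measurable_add[OF Lp_functions_measurable[OF f] Lp_functions_measurable[OF g]])
    show "AE x in M. norm (f x + g x) \<le> Lp_norm M \<infinity> f + Lp_norm M \<infinity> g"
      using Lp_norm_infinity_AE[OF f[unfolded True]] Lp_norm_infinity_AE[OF g[unfolded True]]
      by eventually_elim (rule order_trans[OF norm_triangle_ineq], simp)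
  qed
next
  case False
  note [measurable] = Lp_functions_measurable[OF f] Lp_functions_measurable[OF g]
  have "integrable M (\<lambda>x. norm (f x + g x) powr enn2real p)"
  proof (rule Bochner_Integration.integrable_bound)
    show "integrable M (\<lambda>x. 2 powr enn2real p * (norm (f x) powr enn2real p + norm (g x) powr enn2real p))"
      using assms False by (simp add: Lp_functions_finite_iff)
    show "AE x in M. norm (norm (f x + g x) powr enn2real p)
        \<le> norm (2 powr enn2real p * (norm (f x) powr enn2real p + norm (g x) powr enn2real p))"
    proof (rule AE_I2)
      fix x
      show "norm (norm (f x + g x) powr enn2real p)
        \<le> norm (2 powr enn2real p * (norm (f x) powr enn2real p + norm (g x) powr enn2real p))"
        using norm_add_powr_le[of "enn2real p" "f x" "g x"]
        by (simp add: abs_mult)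
    qed
  qed measurable
  then show ?thesis
    using False by (simp add: Lp_functions_finite_iff)
qed

lemma Lp_functions_scale:
  assumes f: "f \<in> Lp_functions M p"
  shows "(\<lambda>x. c * f x) \<in> Lp_functions M p"
proof (cases "p = \<infinity>")
  case True
  show ?thesis unfolding True
  proof (rule Lp_functions_infinityI)
    show "(\<lambda>x. c * f x) \<in> borel_measurable M"
      using assms by (auto dest: Lp_functions_measurable)
    show "AE x in M. norm (c * f x) \<le> norm c * Lp_norm M \<infinity> f"
      using Lp_norm_infinity_AE[OF f[unfolded True]]
      by eventually_elim (auto simp: norm_mult intro: mult_left_mono)
  qed
next
  case False
  then show ?thesis
    using f by (auto simp: Lp_functions_finite_iff norm_mult powr_mult)
qed

lemma equiv_ae_rel: "equiv (Lp_functions M p) (ae_rel M p)"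
proof (rule equivI)
  show "ae_rel M p \<subseteq> Lp_functions M p \<times> Lp_functions M p"
    by (auto simp: ae_rel_def)
  show "refl_on (Lp_functions M p) (ae_rel M p)"
    by (auto simp: refl_on_def ae_rel_def)
  show "sym (ae_rel M p)"
    by (auto simp: sym_def ae_rel_def elim: eventually_mono)
  show "trans (ae_rel M p)"
    by (auto simp: trans_def ae_rel_def elim: eventually_elim2)
qed

lemma mem_Lp_class:
  "g \<in> Lp_class M p f \<longleftrightarrow>
    f \<in> Lp_functions M p \<and> g \<in> Lp_functions M p \<and> (AE x in M. f x = g x)"
  by (simp add: Lp_class_def ae_rel_def)

lemma Lp_class_eq_iff:
  assumes "f \<in> Lp_functions M p" "g \<in> Lp_functions M p"
  shows "Lp_class M p f = Lp_class M p g \<longleftrightarrow> (AE x in M. f x = g x)"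
  using eq_equiv_class_iff[OF equiv_ae_rel assms] assms
  by (simp add: Lp_class_def ae_rel_def)

lemma Lp_class_in_Lp_space: "f \<in> Lp_functions M p \<Longrightarrow> Lp_class M p f \<in> Lp_space M p"
  by (simp add: Lp_class_def Lp_space_def quotientI)

lemma Lp_spaceE:
  assumes "F \<in> Lp_space M p"
  obtains f where "f \<in> Lp_functions M p" "F = Lp_class M p f"
  using assms by (auto simp: Lp_space_def Lp_class_def elim: quotientE)

lemma Lp_class_self: "f \<in> Lp_functions M p \<Longrightarrow> f \<in> Lp_class M p f"
  by (simp add: mem_Lp_class)

lemma UN_constant_on: "A \<noteq> {} \<Longrightarrow> (\<And>x. x \<in> A \<Longrightarrow> B x = C) \<Longrightarrow> (\<Union>x\<in>A. B x) = C"
  by auto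

lemma Lp_add_class:
  assumes "f \<in> Lp_functions M p" "g \<in> Lp_functions M p"
  shows "Lp_add M p (Lp_class M p f) (Lp_class M p g) = Lp_class M p (\<lambda>x. f x + g x)"
  unfolding Lp_add_def
proof (intro UN_constant_on)
  fix f' g' assume *: "f' \<in> Lp_class M p f" "g' \<in> Lp_class M p g"
  then have "AE x in M. f' x + g' x = f x + g x"
    unfolding mem_Lp_class by (auto elim: eventually_elim2)
  with * show "Lp_class M p (\<lambda>x. f' x + g' x) = Lp_class M p (\<lambda>x. f x + g x)"
    by (subst Lp_class_eq_iff) (auto simp: mem_Lp_class Lp_functions_add)
qed (use assms Lp_class_self in blast)+

lemma Lp_scale_class:
  assumes "f \<in> Lp_functions M p"
  shows "Lp_scale M p c (Lp_class M p f) = Lp_class M p (\<lambda>x. c * f x)"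
  unfolding Lp_scale_def
proof (intro UN_constant_on)
  fix f' assume *: "f' \<in> Lp_class M p f"
  then have "AE x in M. f x = f' x"
    by (simp add: mem_Lp_class)
  then have "AE x in M. c * f' x = c * f x"
    by eventually_elim simp
  with * show "Lp_class M p (\<lambda>x. c * f' x) = Lp_class M p (\<lambda>x. c * f x)"
    by (subst Lp_class_eq_iff) (auto simp: mem_Lp_class Lp_functions_scale)
qed (use assms Lp_class_self in blast)

lemma Lp_class_norm_class:
  assumes "f \<in> Lp_functions M p"
  shows "Lp_class_norm M p (Lp_class M p f) = Lp_norm M p f"
proof -
  have "Lp_norm M p g = Lp_norm M p f" if "g \<in> Lp_class M p f" for g
    using that by (intro Lp_norm_AE_cong) (auto simp: mem_Lp_class Lp_functions_measurable elim: eventually_mono)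
  then have "Lp_norm M p ` Lp_class M p f = {Lp_norm M p f}"
    using Lp_class_self[OF assms] by blast
  then show ?thesis
    by (simp add: Lp_class_norm_def)
qed

text \<open>
  The bridge from formulas to operators: a formula acts on functions, and its linearity is only
  available where its integrals converge, that is almost everywhere, whereas an operator acts on the
  quotient.
\<close>

lemma bounded_operator_Lp_of_representatives:
  fixes L :: "('a \<Rightarrow> complex) \<Rightarrow> ('a \<Rightarrow> complex)"
  assumes maps: "\<And>f. f \<in> Lp_functions M p \<Longrightarrow> L f \<in> Lp_functions M p"
    and cong: "\<And>f g. f \<in> Lp_functions M p \<Longrightarrow> g \<in> Lp_functions M p \<Longrightarrow> AE x in M. f x = g x
                \<Longrightarrow> AE x in M. L f x = L g x"
    and add: "\<And>f g. f \<in> Lp_functions M p \<Longrightarrow> g \<in> Lp_functions M p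
                \<Longrightarrow> AE x in M. L (\<lambda>x. f x + g x) x = L f x + L g x"
    and scale: "\<And>c f. f \<in> Lp_functions M p \<Longrightarrow> AE x in M. L (\<lambda>x. c * f x) x = c * L f x"
    and bound: "\<And>f. f \<in> Lp_functions M p \<Longrightarrow> Lp_norm M p (L f) \<le> C * Lp_norm M p f"
    and C: "0 \<le> C"
  shows "\<exists>T. bounded_operator_Lp M p T \<and>
             (\<forall>f\<in>Lp_functions M p. T (Lp_class M p f) = Lp_class M p (L f)) \<and>
             operator_norm_Lp M p T \<le> C"
proof -
  define T where "T = (\<lambda>F\<in>Lp_space M p. Lp_class M p (L (SOME f. f \<in> F)))"
  have T_class: "T (Lp_class M p f) = Lp_class M p (L f)" if f: "f \<in> Lp_functions M p" for f
  proof -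
    define g where "g = (SOME f'. f' \<in> Lp_class M p f)"
    have "g \<in> Lp_class M p f"
      unfolding g_def using Lp_class_self[OF f] by (rule someI[where P = "\<lambda>f'. f' \<in> Lp_class M p f"])
    then have g: "g \<in> Lp_functions M p" "AE x in M. g x = f x"
      by (auto simp: mem_Lp_class elim: eventually_mono)
    have "T (Lp_class M p f) = Lp_class M p (L g)"
      by (simp add: T_def g_def Lp_class_in_Lp_space f)
    also have "\<dots> = Lp_class M p (L f)"
      using g f by (simp add: Lp_class_eq_iff maps cong)
    finally show ?thesis .
  qed
  have norm_T: "Lp_class_norm M p (T F) \<le> C * Lp_class_norm M p F" if F: "F \<in> Lp_space M p" for F
  proof -
    obtain f where f: "f \<in> Lp_functions M p" "F = Lp_class M p f"
      using F by (rule Lp_spaceE)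
    then show ?thesis
      by (simp only: T_class[OF f(1)] Lp_class_norm_class[OF f(1)] Lp_class_norm_class[OF maps[OF f(1)]] bound[OF f(1)])
  qed
  have "bounded_operator_Lp M p T"
    unfolding bounded_operator_Lp_def
  proof (intro conjI ballI allI)
    show "T \<in> Lp_space M p \<rightarrow>\<^sub>E Lp_space M p"
    proof
      show "T F \<in> Lp_space M p" if "F \<in> Lp_space M p" for F
        using that by (rule Lp_spaceE) (simp only: T_class Lp_class_in_Lp_space[OF maps])
    qed (simp add: T_def)
    show "T (Lp_add M p F G) = Lp_add M p (T F) (T G)"
      if F: "F \<in> Lp_space M p" and G: "G \<in> Lp_space M p" for F G
    proof -
      obtain f where f: "f \<in> Lp_functions M p" "F = Lp_class M p f"
        using F by (rule Lp_spaceE)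
      obtain g where g: "g \<in> Lp_functions M p" "G = Lp_class M p g"
        using G by (rule Lp_spaceE)
      have "T (Lp_add M p F G) = Lp_class M p (L (\<lambda>x. f x + g x))"
        by (simp only: f(2) g(2) Lp_add_class[OF f(1) g(1)] T_class[OF Lp_functions_add[OF f(1) g(1)]])
      also have "\<dots> = Lp_class M p (\<lambda>x. L f x + L g x)"
        using f g by (subst Lp_class_eq_iff) (auto intro!: maps Lp_functions_add add)
      also have "\<dots> = Lp_add M p (T F) (T G)"
        by (simp only: f(2) g(2) T_class[OF f(1)] T_class[OF g(1)] Lp_add_class[OF maps[OF f(1)] maps[OF g(1)]])
      finally show ?thesis .
    qed
    show "T (Lp_scale M p c F) = Lp_scale M p c (T F)" if F: "F \<in> Lp_space M p" for c F
    proof -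
      obtain f where f: "f \<in> Lp_functions M p" "F = Lp_class M p f"
        using F by (rule Lp_spaceE)
      have "T (Lp_scale M p c F) = Lp_class M p (L (\<lambda>x. c * f x))"
        by (simp only: f(2) Lp_scale_class[OF f(1)] T_class[OF Lp_functions_scale[OF f(1)]])
      also have "\<dots> = Lp_class M p (\<lambda>x. c * L f x)"
        using f by (subst Lp_class_eq_iff) (auto intro!: maps Lp_functions_scale scale)
      also have "\<dots> = Lp_scale M p c (T F)"
        by (simp only: f(2) T_class[OF f(1)] Lp_scale_class[OF maps[OF f(1)]])
      finally show ?thesis .
    qed
    show "\<exists>C. \<forall>F\<in>Lp_space M p. Lp_class_norm M p (T F) \<le> C * Lp_class_norm M p F"
      using norm_T by blast
  qed
  moreover have "operator_norm_Lp M p T \<le> C"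
    unfolding operator_norm_Lp_def
  proof (rule cSUP_least)
    have "(\<lambda>x. 0) \<in> Lp_functions M p"
      using Lp_functions_infinityI[of "\<lambda>x. 0" M 0]
      by (cases "p = \<infinity>") (simp_all add: Lp_functions_finite_iff)
    then show "Lp_space M p \<noteq> {}"
      using Lp_class_in_Lp_space by blast
    show "Lp_class_norm M p (T F) / Lp_class_norm M p F \<le> C" if F: "F \<in> Lp_space M p" for F
    proof -
      have "0 \<le> Lp_class_norm M p F"
        using F by (rule Lp_spaceE) (simp only: Lp_class_norm_class Lp_norm_nonneg)
      then show ?thesis
        using norm_T[OF F] C by (cases "Lp_class_norm M p F = 0") (auto simp: field_simps)
    qed
  qed
  ultimately show ?thesis
    using T_class by blast
qed

text \<open>
  Operators are extensional and every class has a representative, so the values on classes of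
  representatives determine an operator.
\<close>

lemma bounded_operator_Lp_eqI:
  assumes "bounded_operator_Lp M p S" "bounded_operator_Lp M p T"
    and "\<And>f. f \<in> Lp_functions M p \<Longrightarrow> S (Lp_class M p f) = T (Lp_class M p f)"
  shows "S = T"
proof (rule PiE_ext)
  show "S \<in> Lp_space M p \<rightarrow>\<^sub>E Lp_space M p" "T \<in> Lp_space M p \<rightarrow>\<^sub>E Lp_space M p"
    using assms(1,2) by (auto simp: bounded_operator_Lp_def)
  show "S F = T F" if "F \<in> Lp_space M p" for F
    using that by (rule Lp_spaceE) (simp only: assms(3))
qed

section \<open>Superpositions of rank-one operators with balanced kernels\<close>

text \<open>
  Young's inequality with exponents \<open>r\<close> and \<open>r / (r - 1)\<close>, in the form of a tangent line of the
  convex function \<open>u powr r\<close> at \<open>t\<close>; this form also covers \<open>r = 1\<close>.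
\<close>

lemma powr_tangent_le:
  fixes t u r :: real
  assumes "0 < t" "0 \<le> u" "1 \<le> r"
  shows "u \<le> t powr (1 - r) / r * u powr r + (1 - 1 / r) * t"
proof (cases "u = 0")
  case False
  with assms have "(u powr r) powr (1 / r) * (t powr r) powr (1 - 1 / r)
      \<le> (1 / r) * u powr r + (1 - 1 / r) * t powr r"
    by (intro Youngs_inequality_0) auto
  then have "u * t powr (r - 1) \<le> u powr r / r + (1 - 1 / r) * t powr r"
    using assms by (simp add: powr_powr right_diff_distrib)
  then have "t powr (1 - r) * (u * t powr (r - 1))
      \<le> t powr (1 - r) * (u powr r / r + (1 - 1 / r) * t powr r)"
    by (rule mult_left_mono) simp
  moreover have "t powr (1 - r) * (u * t powr (r - 1)) = u"
    using assms by (simp add: mult.left_commute flip: powr_add)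
  moreover have "t powr (1 - r) * ((1 - 1 / r) * t powr r) = (1 - 1 / r) * t"
    using assms by (simp add: mult.left_commute flip: powr_add)
  ultimately show ?thesis
    by (simp add: distrib_left)
qed (use assms in auto)

text \<open>
  Jensen's inequality for a weight of total mass at most \<open>A\<close>. For \<open>A = 0\<close> the weight vanishes almost
  everywhere, so the right-hand side may be \<open>0\<close>, which it is by the convention \<open>0 powr s = 0\<close>
  (also for \<open>s = 0\<close>).
\<close>

lemma nn_integral_powr_Jensen:
  fixes w g :: "'a \<Rightarrow> real"
  assumes [measurable]: "w \<in> borel_measurable M" "g \<in> borel_measurable M"
    and nonneg: "\<And>x. 0 \<le> w x" "\<And>x. 0 \<le> g x"
    and r: "1 \<le> r" and A: "0 \<le> A" and I: "0 \<le> I"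
    and mass: "(\<integral>\<^sup>+x. w x \<partial>M) \<le> ennreal A"
    and moment: "(\<integral>\<^sup>+x. w x * g x powr r \<partial>M) \<le> ennreal I"
  shows "(\<integral>\<^sup>+x. w x * g x \<partial>M) \<le> ennreal ((A powr (r - 1) * I) powr (1 / r))"
proof (cases "A = 0")
  case True
  then have "AE x in M. w x = 0"
    using mass nonneg by (simp add: nn_integral_0_iff_AE antisym)
  then have "(\<integral>\<^sup>+x. w x * g x \<partial>M) = (\<integral>\<^sup>+x. 0 \<partial>M)"
    by (intro nn_integral_cong_AE) auto
  then show ?thesis by simp
next
  case False
  then have A: "0 < A" using A by simp
  let ?H = "\<integral>\<^sup>+x. w x * g x \<partial>M"
  have tangent: "?H \<le> ennreal (t powr (1 - r) / r * I + (1 - 1 / r) * t * A)" if t: "0 < t" for t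
  proof -
    have "?H \<le> (\<integral>\<^sup>+x. ennreal (t powr (1 - r) / r) * ennreal (w x * g x powr r)
                  + ennreal ((1 - 1 / r) * t) * ennreal (w x) \<partial>M)"
    proof (rule nn_integral_mono)
      fix x
      have "w x * g x \<le> w x * (t powr (1 - r) / r * g x powr r + (1 - 1 / r) * t)"
        using powr_tangent_le[OF t nonneg(2)[of x] r] nonneg(1)[of x] by (rule mult_left_mono)
      also have "\<dots> = t powr (1 - r) / r * (w x * g x powr r) + (1 - 1 / r) * t * w x"
        by (simp add: algebra_simps)
      finally show "ennreal (w x * g x) \<le> ennreal (t powr (1 - r) / r) * ennreal (w x * g x powr r)
                  + ennreal ((1 - 1 / r) * t) * ennreal (w x)"
        using r t nonneg[of x] by (simp flip: ennreal_mult ennreal_plus)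
    qed
    also have "\<dots> = ennreal (t powr (1 - r) / r) * (\<integral>\<^sup>+x. w x * g x powr r \<partial>M)
                  + ennreal ((1 - 1 / r) * t) * (\<integral>\<^sup>+x. w x \<partial>M)"
      by (simp add: nn_integral_add nn_integral_cmult)
    also have "\<dots> \<le> ennreal (t powr (1 - r) / r) * ennreal I + ennreal ((1 - 1 / r) * t) * ennreal A"
      by (intro add_mono mult_left_mono mass moment) auto
    also have "\<dots> = ennreal (t powr (1 - r) / r * I + (1 - 1 / r) * t * A)"
      using r t I A by (simp flip: ennreal_mult ennreal_plus)
    finally show ?thesis .
  qed
  then have "?H < \<infinity>"
    by (metis ennreal_less_top infinity_ennreal_def order_le_less_trans zero_less_one)
  then obtain h where h: "0 \<le> h" "?H = ennreal h"
    by (cases ?H) auto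
  have "h \<le> (A powr (r - 1) * I) powr (1 / r)"
  proof (cases "h = 0")
    case False
    with h have h0: "0 < h" by simp
    \<comment> \<open>The tangent is taken at the weighted mean of \<open>g\<close>.\<close>
    define t where "t = h / A"
    have t: "0 < t" using h0 A by (simp add: t_def)
    have "h \<le> t powr (1 - r) / r * I + (1 - 1 / r) * t * A"
    proof -
      have "0 \<le> t powr (1 - r) / r * I + (1 - 1 / r) * t * A"
        using r t I A by (intro add_nonneg_nonneg mult_nonneg_nonneg) auto
      then show ?thesis
        using tangent[OF t] h by simp
    qed
    also have "(1 - 1 / r) * t * A = h - h / r"
      using A by (simp add: t_def algebra_simps)
    finally have "h / r \<le> t powr (1 - r) * I / r"
      by simp
    then have "h \<le> t powr (1 - r) * I"
      using r by (simp add: divide_le_cancel)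
    then have "h powr (r - 1) * h \<le> h powr (r - 1) * (t powr (1 - r) * I)"
      by (rule mult_left_mono) simp
    also have "t powr (1 - r) = h powr (1 - r) * A powr (r - 1)"
      using h0 A by (simp add: t_def powr_divide powr_diff)
    also have "h powr (r - 1) * (h powr (1 - r) * A powr (r - 1) * I) = A powr (r - 1) * I"
      using h0 by (simp add: mult.assoc[symmetric] flip: powr_add)
    also have "h powr (r - 1) * h = h powr r"
      using h0 by (simp add: powr_diff)
    finally have "(h powr r) powr (1 / r) \<le> (A powr (r - 1) * I) powr (1 / r)"
      using r by (intro powr_mono2) auto
    then show ?thesis
      using h0 r by (simp add: powr_powr)
  qed simp
  then show ?thesis
    by (simp add: h ennreal_leI)
qed

lemma borel_measurable_cnj [measurable (raw)]:
  assumes "f \<in> borel_measurable M"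
  shows "(\<lambda>x. cnj (f x)) \<in> borel_measurable M"
  by (rule borel_measurable_continuous_on[OF continuous_on_cnj[OF continuous_on_id] assms])

text \<open>
  \<open>P z\<close> and \<open>Q z\<close> are the two windows at the point \<open>z\<close> of the parameter space, and the operator is the
  superposition of the rank-one operators \<open>f \<mapsto> \<langle>f, P z\<rangle> Q z\<close> with density \<open>\<sigma>\<close>.
  The factor \<open>c z\<close> may be arbitrarily large or small, but it scales the \<open>L1\<close> and the
  \<open>L\<infinity>\<close> bounds in opposite directions, so that it cancels in every product of an \<open>L1\<close> bound of one
  window with an \<open>L\<infinity>\<close> bound of the other.
\<close>

locale balanced_kernels = X: sigma_finite_measure X + M: sigma_finite_measure M
  for X :: "'z measure" and M :: "'a measure" +
  fixes P Q :: "'z \<Rightarrow> 'a \<Rightarrow> complex" and c :: "'z \<Rightarrow> real" and \<sigma> :: "'z \<Rightarrow> complex"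
    and P1 Pinf Q1 Qinf :: real
  assumes P_measurable: "case_prod P \<in> borel_measurable (X \<Otimes>\<^sub>M M)"
    and Q_measurable: "case_prod Q \<in> borel_measurable (X \<Otimes>\<^sub>M M)"
    and c_measurable: "c \<in> borel_measurable X"
    and c_pos: "z \<in> space X \<Longrightarrow> 0 < c z"
    and bounds_nonneg: "0 \<le> P1" "0 \<le> Pinf" "0 \<le> Q1" "0 \<le> Qinf"
    and P_L1: "z \<in> space X \<Longrightarrow> (\<integral>\<^sup>+y. norm (P z y) \<partial>M) \<le> ennreal (c z * P1)"
    and P_Linf: "z \<in> space X \<Longrightarrow> AE y in M. norm (P z y) \<le> Pinf / c z"
    and Q_L1: "z \<in> space X \<Longrightarrow> (\<integral>\<^sup>+y. norm (Q z y) \<partial>M) \<le> ennreal (c z * Q1)"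
    and Q_Linf: "z \<in> space X \<Longrightarrow> AE y in M. norm (Q z y) \<le> Qinf / c z"
    and \<sigma>_integrable: "integrable X \<sigma>"
begin

sublocale XM: pair_sigma_finite X M ..

declare P_measurable[measurable] Q_measurable[measurable] c_measurable[measurable]

lemma \<sigma>_measurable [measurable]: "\<sigma> \<in> borel_measurable X"
  using \<sigma>_integrable by simp

definition coefficient :: "('a \<Rightarrow> complex) \<Rightarrow> 'z \<Rightarrow> complex" where
  "coefficient f z = (LINT y|M. f y * cnj (P z y))"

definition superposition :: "('a \<Rightarrow> complex) \<Rightarrow> 'a \<Rightarrow> complex" where
  "superposition f y = (LINT z|X. \<sigma> z * coefficient f z * Q z y)"

definition symbol_mass :: real where "symbol_mass = (LINT z|X. norm (\<sigma> z))"

lemma symbol_mass_nonneg: "0 \<le> symbol_mass"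
  by (simp add: symbol_mass_def)

lemma nn_integral_\<sigma>: "(\<integral>\<^sup>+z. norm (\<sigma> z) \<partial>X) = ennreal symbol_mass"
  unfolding symbol_mass_def using \<sigma>_integrable by (intro nn_integral_eq_integral) auto

lemma P_section [measurable]: "z \<in> space X \<Longrightarrow> P z \<in> borel_measurable M"
  using measurable_compose[OF measurable_Pair1' P_measurable] by simp

lemma Q_section [measurable]: "z \<in> space X \<Longrightarrow> Q z \<in> borel_measurable M"
  using measurable_compose[OF measurable_Pair1' Q_measurable] by simp

lemma Q_section': "y \<in> space M \<Longrightarrow> (\<lambda>z. Q z y) \<in> borel_measurable X"
  using measurable_compose[OF measurable_Pair2' Q_measurable] by simp

text \<open>
  Since \<open>u \<le> 1 + u powr r\<close>, the integrand is dominated by \<open>norm (P z y)\<close>, which is integrable, plus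
  \<open>norm (f y) powr r\<close> times the essential bound of \<open>P z\<close>.
\<close>

lemma coefficient_integrable:
  assumes f: "f \<in> Lp_functions M p" and p: "1 \<le> p" and z: "z \<in> space X"
  shows "integrable M (\<lambda>y. f y * cnj (P z y))"
proof -
  note [measurable] = Lp_functions_measurable[OF f] P_section[OF z]
  have P: "integrable M (P z)"
    using P_L1[OF z] by (intro integrableI_bounded) (auto intro: order_le_less_trans)
  show ?thesis
  proof (cases "p = \<infinity>")
    case True
    show ?thesis
    proof (rule Bochner_Integration.integrable_bound)
      show "integrable M (\<lambda>y. Lp_norm M \<infinity> f * norm (P z y))"
        using P by simp
      show "AE y in M. norm (f y * cnj (P z y)) \<le> norm (Lp_norm M \<infinity> f * norm (P z y))"
        using Lp_norm_infinity_AE[OF f[unfolded True]]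
        by eventually_elim (auto simp: norm_mult Lp_norm_nonneg intro: mult_right_mono)
    qed measurable
  next
    case False
    define r where "r = enn2real p"
    have r: "1 \<le> r"
      using p False unfolding r_def by (cases p) auto
    show ?thesis
    proof (rule Bochner_Integration.integrable_bound)
      show "integrable M (\<lambda>y. norm (P z y) + Pinf / c z * norm (f y) powr r)"
        using P f False by (simp add: Lp_functions_finite_iff r_def)
      show "AE y in M. norm (f y * cnj (P z y)) \<le> norm (norm (P z y) + Pinf / c z * norm (f y) powr r)"
        using P_Linf[OF z]
      proof eventually_elim
        case (elim y)
        have "norm (f y) \<le> 1 + norm (f y) powr r"
        proof (cases "norm (f y) \<le> 1")
          case False
          then have "norm (f y) powr 1 \<le> norm (f y) powr r"
            using r by (intro powr_mono) auto
          then show ?thesis by simp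
        qed (simp add: add_increasing2)
        then have "norm (f y) * norm (P z y) \<le> (1 + norm (f y) powr r) * norm (P z y)"
          by (rule mult_right_mono) simp
        also have "\<dots> \<le> norm (P z y) + Pinf / c z * norm (f y) powr r"
          using mult_right_mono[OF elim, of "norm (f y) powr r"] by (simp add: algebra_simps)
        finally show ?case by (simp add: norm_mult)
      qed
    qed measurable
  qed
qed

lemma coefficient_measurable:
  assumes [measurable]: "f \<in> borel_measurable M"
  shows "coefficient f \<in> borel_measurable X"
  unfolding coefficient_def by (rule M.borel_measurable_lebesgue_integral) measurable

lemma superposition_integrand_measurable:
  assumes [measurable]: "f \<in> borel_measurable M"
  shows "(\<lambda>(y, z). \<sigma> z * coefficient f z * Q z y) \<in> borel_measurable (M \<Otimes>\<^sub>M X)"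
proof -
  have [measurable]: "coefficient f \<in> borel_measurable X"
    by (rule coefficient_measurable) fact
  have [measurable]: "(\<lambda>(y, z). Q z y) \<in> borel_measurable (M \<Otimes>\<^sub>M X)"
    using measurable_pair_swap[OF Q_measurable] by (simp add: split_beta')
  show ?thesis by measurable
qed

lemma superposition_measurable:
  assumes [measurable]: "f \<in> borel_measurable M"
  shows "superposition f \<in> borel_measurable M"
  unfolding superposition_def
  using superposition_integrand_measurable[OF assms] by (rule X.borel_measurable_lebesgue_integral)

text \<open>The modulus of the kernel of the superposition, before integration over the parameter.\<close>

definition weight :: "'a \<Rightarrow> 'z \<times> 'a \<Rightarrow> real" where
  "weight y = (\<lambda>(z, w). norm (\<sigma> z) * norm (P z w) * norm (Q z y))"

lemma weight_nonneg: "0 \<le> weight y v"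
  by (simp add: weight_def split_beta)

lemma weight_measurable: "y \<in> space M \<Longrightarrow> weight y \<in> borel_measurable (X \<Otimes>\<^sub>M M)"
  using Q_section'[of y] unfolding weight_def by measurable

text \<open>
  Bounds for the masses of the kernel \<open>(y, w) \<mapsto> \<integral> weight y (z, w) dz\<close> over a row (\<open>y\<close> fixed) and over a column
  (\<open>w\<close> fixed). In the first the factor \<open>c z\<close> of the \<open>L1\<close> norm of \<open>P z\<close> meets the factor \<open>1 / c z\<close> of
  the bound of \<open>Q z\<close>, in the second it is the other way round.
\<close>

definition row_mass :: real where "row_mass = P1 * Qinf * symbol_mass"
definition column_mass :: real where "column_mass = Pinf * Q1 * symbol_mass"

lemma row_mass_nonneg: "0 \<le> row_mass" and column_mass_nonneg: "0 \<le> column_mass"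
  by (simp_all add: row_mass_def column_mass_def bounds_nonneg symbol_mass_nonneg)

lemma nn_integral_weight:
  assumes y: "y \<in> space M" and [measurable]: "g \<in> borel_measurable M"
    and g: "\<And>w. 0 \<le> g w"
  shows "(\<integral>\<^sup>+v. weight y v * g (snd v) \<partial>(X \<Otimes>\<^sub>M M)) =
    (\<integral>\<^sup>+z. ennreal (norm (\<sigma> z)) * (ennreal (norm (Q z y)) * (\<integral>\<^sup>+w. norm (P z w) * g w \<partial>M)) \<partial>X)"
proof -
  note [measurable] = weight_measurable[OF y]
  have "(\<integral>\<^sup>+v. weight y v * g (snd v) \<partial>(X \<Otimes>\<^sub>M M)) =
      (\<integral>\<^sup>+z. \<integral>\<^sup>+w. weight y (z, w) * g w \<partial>M \<partial>X)"
    by (subst M.nn_integral_fst[symmetric]) auto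
  also have "\<dots> = (\<integral>\<^sup>+z. \<integral>\<^sup>+w. ennreal (norm (\<sigma> z)) * (ennreal (norm (Q z y)) * ennreal (norm (P z w) * g w)) \<partial>M \<partial>X)"
    by (intro nn_integral_cong) (simp add: weight_def g mult_ac flip: ennreal_mult)
  also have "\<dots> = (\<integral>\<^sup>+z. ennreal (norm (\<sigma> z)) * (ennreal (norm (Q z y)) * (\<integral>\<^sup>+w. norm (P z w) * g w \<partial>M)) \<partial>X)"
    by (intro nn_integral_cong) (simp add: nn_integral_cmult)
  finally show ?thesis .
qed

text \<open>
  The bound of \<open>Q z\<close> holds off a null set that depends on \<open>z\<close>; Fubini exchanges the two quantifiers.
\<close>

lemma AE_Q_le: "AE y in M. AE z in X. norm (Q z y) \<le> Qinf / c z"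
proof -
  have "AE z in X. AE y in M. norm (Q z y) \<le> Qinf / c z"
    by (rule AE_I2) (rule Q_Linf)
  then show ?thesis
    by (subst (asm) XM.AE_commute) measurable
qed

lemma AE_weight_mass_le: "AE y in M. (\<integral>\<^sup>+v. weight y v \<partial>(X \<Otimes>\<^sub>M M)) \<le> ennreal row_mass"
  using AE_Q_le AE_space
proof eventually_elim
  case (elim y)
  have "(\<integral>\<^sup>+v. weight y v \<partial>(X \<Otimes>\<^sub>M M)) =
      (\<integral>\<^sup>+z. ennreal (norm (\<sigma> z)) * (ennreal (norm (Q z y)) * (\<integral>\<^sup>+w. norm (P z w) \<partial>M)) \<partial>X)"
    using nn_integral_weight[OF elim(2), of "\<lambda>_. 1"] by simp
  also have "\<dots> \<le> (\<integral>\<^sup>+z. ennreal (norm (\<sigma> z)) * ennreal (P1 * Qinf) \<partial>X)"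
  proof (rule nn_integral_mono_AE)
    show "AE z in X. ennreal (norm (\<sigma> z)) * (ennreal (norm (Q z y)) * (\<integral>\<^sup>+w. norm (P z w) \<partial>M))
        \<le> ennreal (norm (\<sigma> z)) * ennreal (P1 * Qinf)"
      using elim(1) AE_space
    proof eventually_elim
      case (elim z)
      have "ennreal (norm (Q z y)) * (\<integral>\<^sup>+w. norm (P z w) \<partial>M) \<le> ennreal (Qinf / c z) * ennreal (c z * P1)"
        using elim P_L1[of z] by (intro mult_mono ennreal_leI) auto
      also have "\<dots> = ennreal (P1 * Qinf)"
        using c_pos[of z] elim(2) bounds_nonneg by (simp add: mult.commute flip: ennreal_mult)
      finally show ?case by (rule mult_left_mono) simp
    qed
  qed
  also have "\<dots> = ennreal row_mass"
    by (subst nn_integral_multc)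
       (simp_all add: nn_integral_\<sigma> row_mass_def symbol_mass_nonneg bounds_nonneg mult_ac flip: ennreal_mult)
  finally show ?case .
qed

text \<open>
  The column estimate, tested against \<open>g\<close>: the bound of \<open>P z\<close> frees the inner integral from the window,
  and what remains of the dependence on \<open>y\<close> is the \<open>L1\<close> norm of \<open>Q z\<close>.
\<close>

lemma nn_integral_weight_integral_le:
  assumes [measurable]: "g \<in> borel_measurable M" and g: "\<And>w. 0 \<le> g w"
  shows "(\<integral>\<^sup>+y. \<integral>\<^sup>+v. weight y v * g (snd v) \<partial>(X \<Otimes>\<^sub>M M) \<partial>M) \<le> ennreal column_mass * (\<integral>\<^sup>+w. g w \<partial>M)"
proof -
  let ?G = "\<lambda>z. \<integral>\<^sup>+w. norm (P z w) * g w \<partial>M"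
  have [measurable]: "?G \<in> borel_measurable X"
    by (rule M.borel_measurable_nn_integral) measurable
  have "(\<integral>\<^sup>+y. \<integral>\<^sup>+v. weight y v * g (snd v) \<partial>(X \<Otimes>\<^sub>M M) \<partial>M) =
      (\<integral>\<^sup>+y. \<integral>\<^sup>+z. ennreal (norm (\<sigma> z)) * (ennreal (norm (Q z y)) * ?G z) \<partial>X \<partial>M)"
    by (intro nn_integral_cong nn_integral_weight g) auto
  also have "\<dots> = (\<integral>\<^sup>+z. \<integral>\<^sup>+y. ennreal (norm (\<sigma> z)) * (ennreal (norm (Q z y)) * ?G z) \<partial>M \<partial>X)"
    by (rule XM.Fubini') measurable
  also have "\<dots> = (\<integral>\<^sup>+z. ennreal (norm (\<sigma> z)) * ((\<integral>\<^sup>+y. norm (Q z y) \<partial>M) * ?G z) \<partial>X)"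
    by (intro nn_integral_cong) (simp add: nn_integral_cmult nn_integral_multc)
  also have "\<dots> \<le> (\<integral>\<^sup>+z. ennreal (norm (\<sigma> z)) * (ennreal (Pinf * Q1) * (\<integral>\<^sup>+w. g w \<partial>M)) \<partial>X)"
  proof (intro nn_integral_mono mult_left_mono)
    fix z assume z: "z \<in> space X"
    have "?G z \<le> (\<integral>\<^sup>+w. ennreal (Pinf / c z) * ennreal (g w) \<partial>M)"
    proof (rule nn_integral_mono_AE)
      show "AE w in M. ennreal (norm (P z w) * g w) \<le> ennreal (Pinf / c z) * ennreal (g w)"
        using P_Linf[OF z]
      proof eventually_elim
        case (elim w)
        show ?case
          using mult_right_mono[OF elim g] c_pos[OF z] bounds_nonneg g
          by (subst ennreal_mult[symmetric]) (auto intro: ennreal_leI)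
      qed
    qed
    also have "\<dots> = ennreal (Pinf / c z) * (\<integral>\<^sup>+w. g w \<partial>M)"
      by (simp add: nn_integral_cmult)
    finally have "(\<integral>\<^sup>+y. norm (Q z y) \<partial>M) * ?G z
        \<le> ennreal (c z * Q1) * (ennreal (Pinf / c z) * (\<integral>\<^sup>+w. g w \<partial>M))"
      using Q_L1[OF z] by (intro mult_mono) auto
    also have "\<dots> = ennreal (Pinf * Q1) * (\<integral>\<^sup>+w. g w \<partial>M)"
      using c_pos[OF z] bounds_nonneg
      by (simp add: mult.assoc[symmetric] flip: ennreal_mult) (simp add: mult.commute)
    finally show "(\<integral>\<^sup>+y. norm (Q z y) \<partial>M) * ?G z \<le> ennreal (Pinf * Q1) * (\<integral>\<^sup>+w. g w \<partial>M)" .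
  qed simp
  also have "\<dots> = ennreal symbol_mass * (ennreal (Pinf * Q1) * (\<integral>\<^sup>+w. g w \<partial>M))"
    by (simp add: nn_integral_multc nn_integral_\<sigma>)
  also have "\<dots> = ennreal column_mass * (\<integral>\<^sup>+w. g w \<partial>M)"
    using symbol_mass_nonneg bounds_nonneg
    by (simp add: column_mass_def ennreal_mult mult_ac)
  finally show ?thesis .
qed

lemma superposition_integrand_le:
  assumes f [measurable]: "f \<in> borel_measurable M" and y: "y \<in> space M"
  shows "(\<integral>\<^sup>+z. norm (\<sigma> z * coefficient f z * Q z y) \<partial>X)
    \<le> (\<integral>\<^sup>+v. weight y v * norm (f (snd v)) \<partial>(X \<Otimes>\<^sub>M M))"
proof -
  have "norm (\<sigma> z * coefficient f z * Q z y)
    \<le> ennreal (norm (\<sigma> z)) * (ennreal (norm (Q z y)) * (\<integral>\<^sup>+w. norm (P z w) * norm (f w) \<partial>M))" for z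
  proof -
    have "ennreal (norm (coefficient f z)) \<le> (\<integral>\<^sup>+w. norm (f w * cnj (P z w)) \<partial>M)"
      unfolding coefficient_def
      by (cases "integrable M (\<lambda>w. f w * cnj (P z w))")
         (auto simp: integral_norm_bound_ennreal not_integrable_integral_eq)
    also have "\<dots> = (\<integral>\<^sup>+w. norm (P z w) * norm (f w) \<partial>M)"
      by (simp add: norm_mult mult.commute)
    finally show ?thesis
      by (simp add: norm_mult ennreal_mult mult_ac mult_left_mono)
  qed
  then have "(\<integral>\<^sup>+z. norm (\<sigma> z * coefficient f z * Q z y) \<partial>X) \<le> (\<integral>\<^sup>+z. ennreal (norm (\<sigma> z)) * (ennreal (norm (Q z y)) * (\<integral>\<^sup>+w. norm (P z w) * norm (f w) \<partial>M)) \<partial>X)"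
    by (intro nn_integral_mono)
  also have "\<dots> = (\<integral>\<^sup>+v. weight y v * norm (f (snd v)) \<partial>(X \<Otimes>\<^sub>M M))"
    using y by (subst nn_integral_weight) auto
  finally show ?thesis .
qed

lemma superposition_integrableI:
  assumes f: "f \<in> borel_measurable M" and y: "y \<in> space M"
    and le: "(\<integral>\<^sup>+v. weight y v * norm (f (snd v)) \<partial>(X \<Otimes>\<^sub>M M)) \<le> ennreal b"
  shows "integrable X (\<lambda>z. \<sigma> z * coefficient f z * Q z y)"
    and "0 \<le> b \<Longrightarrow> norm (superposition f y) \<le> b"
proof -
  have "(\<lambda>z. \<sigma> z * coefficient f z * Q z y) \<in> borel_measurable X"
    using coefficient_measurable[OF f] Q_section'[OF y] by measurable
  moreover have *: "(\<integral>\<^sup>+z. norm (\<sigma> z * coefficient f z * Q z y) \<partial>X) \<le> ennreal b"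
    using superposition_integrand_le[OF f y] le by (rule order_trans)
  ultimately show int: "integrable X (\<lambda>z. \<sigma> z * coefficient f z * Q z y)"
    by (intro integrableI_bounded) (auto intro: order_le_less_trans)
  show "norm (superposition f y) \<le> b" if "0 \<le> b"
  proof -
    have "ennreal (norm (superposition f y)) \<le> ennreal b"
      unfolding superposition_def using integral_norm_bound_ennreal[OF int] * by (rule order_trans)
    then show ?thesis using that by simp
  qed
qed

lemma superposition_infinity:
  assumes f: "f \<in> Lp_functions M \<infinity>"
  shows "AE y in M. integrable X (\<lambda>z. \<sigma> z * coefficient f z * Q z y) \<and>
    norm (superposition f y) \<le> row_mass * Lp_norm M \<infinity> f"
  using AE_weight_mass_le AE_space
proof eventually_elim
  case (elim y)
  let ?N = "Lp_norm M \<infinity> f"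
  note [measurable] = Lp_functions_measurable[OF f] weight_measurable[OF elim(2)]
  have "(\<integral>\<^sup>+v. weight y v * norm (f (snd v)) \<partial>(X \<Otimes>\<^sub>M M))
      \<le> (\<integral>\<^sup>+v. ennreal (weight y v) * ennreal ?N \<partial>(X \<Otimes>\<^sub>M M))"
  proof (rule nn_integral_mono_AE)
    have "AE v in X \<Otimes>\<^sub>M M. norm (f (snd v)) \<le> ?N"
      by (rule XM.AE_pair_measure) (use Lp_norm_infinity_AE[OF f] in \<open>auto intro: AE_I2\<close>)
    then show "AE v in X \<Otimes>\<^sub>M M. ennreal (weight y v * norm (f (snd v))) \<le> ennreal (weight y v) * ennreal ?N"
      by eventually_elim
         (auto simp: weight_nonneg Lp_norm_nonneg simp flip: ennreal_mult intro!: ennreal_leI mult_left_mono)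
  qed
  also have "\<dots> \<le> ennreal row_mass * ennreal ?N"
    using elim(1) by (simp add: nn_integral_multc mult_right_mono)
  finally have "(\<integral>\<^sup>+v. weight y v * norm (f (snd v)) \<partial>(X \<Otimes>\<^sub>M M)) \<le> ennreal (row_mass * ?N)"
    by (simp add: row_mass_nonneg Lp_norm_nonneg ennreal_mult)
  from superposition_integrableI[OF Lp_functions_measurable[OF f] elim(2) this]
  show ?case by (simp add: row_mass_nonneg Lp_norm_nonneg)
qed

text \<open>
  Schur's test. For almost every fixed \<open>y\<close>, Jensen's inequality for the weight, whose mass is at most
  \<open>row_mass\<close>, bounds \<open>norm (superposition f y) powr r\<close> by the weighted integral of
  \<open>norm (f w) powr r\<close>; its integral over \<open>y\<close> is controlled by \<open>column_mass\<close>. The same finiteness gives the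
  convergence of the integral that defines the superposition.
\<close>

lemma superposition_finite:
  assumes f: "f \<in> borel_measurable M" "integrable M (\<lambda>x. norm (f x) powr r)" and r: "1 \<le> r"
  shows "AE y in M. integrable X (\<lambda>z. \<sigma> z * coefficient f z * Q z y)"
    and "(\<integral>\<^sup>+y. norm (superposition f y) powr r \<partial>M)
      \<le> ennreal (row_mass powr (r - 1) * column_mass * (LINT x|M. norm (f x) powr r))"
proof -
  note [measurable] = f(1)
  let ?J = "\<lambda>y. \<integral>\<^sup>+v. weight y v * norm (f (snd v)) powr r \<partial>(X \<Otimes>\<^sub>M M)"
  have [measurable]: "(\<lambda>(y, v). weight y v * norm (f (snd v)) powr r) \<in> borel_measurable (M \<Otimes>\<^sub>M (X \<Otimes>\<^sub>M M))"
  proof -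
    have "(\<lambda>u. case_prod Q (fst (snd u), fst u)) \<in> borel_measurable (M \<Otimes>\<^sub>M (X \<Otimes>\<^sub>M M))"
      by (rule measurable_compose[OF _ Q_measurable]) measurable
    moreover have "(\<lambda>u. case_prod P (snd u)) \<in> borel_measurable (M \<Otimes>\<^sub>M (X \<Otimes>\<^sub>M M))"
      by (rule measurable_compose[OF _ P_measurable]) measurable
    moreover have "(\<lambda>(y, v). weight y v * norm (f (snd v)) powr r) =
       (\<lambda>u. norm (\<sigma> (fst (snd u))) * norm (case_prod P (snd u)) * norm (case_prod Q (fst (snd u), fst u))
          * norm (f (snd (snd u))) powr r)"
      by (auto simp: weight_def split_beta fun_eq_iff)
    ultimately show ?thesis by simp measurable
  qed
  have J_meas [measurable]: "?J \<in> borel_measurable M"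
    by (rule XM.P.borel_measurable_nn_integral) measurable
  have J: "(\<integral>\<^sup>+y. ?J y \<partial>M) \<le> ennreal column_mass * ennreal (LINT x|M. norm (f x) powr r)"
    using nn_integral_weight_integral_le[of "\<lambda>x. norm (f x) powr r"] f
    by (simp add: nn_integral_eq_integral)
  also have "\<dots> < \<infinity>"
    by (simp add: ennreal_mult_less_top)
  finally have "AE y in M. ?J y \<noteq> \<infinity>"
    by (intro nn_integral_PInf_AE) auto
  then have pointwise: "AE y in M. integrable X (\<lambda>z. \<sigma> z * coefficient f z * Q z y) \<and>
      ennreal (norm (superposition f y) powr r) \<le> ennreal (row_mass powr (r - 1)) * ?J y"
    using AE_weight_mass_le AE_space
  proof eventually_elim
    case (elim y)
    note [measurable] = weight_measurable[OF elim(3)]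
    obtain j where j: "0 \<le> j" "?J y = ennreal j"
      using elim(1) by (cases "?J y") auto
    let ?b = "(row_mass powr (r - 1) * j) powr (1 / r)"
    have "(\<integral>\<^sup>+v. weight y v * norm (f (snd v)) \<partial>(X \<Otimes>\<^sub>M M)) \<le> ennreal ?b"
      using elim(2) j r row_mass_nonneg
      by (intro nn_integral_powr_Jensen) (auto simp: weight_nonneg)
    from superposition_integrableI[OF f(1) elim(3) this]
    have int: "integrable X (\<lambda>z. \<sigma> z * coefficient f z * Q z y)" and le: "norm (superposition f y) \<le> ?b"
      by simp_all
    have "norm (superposition f y) powr r \<le> ?b powr r"
      using le r by (intro powr_mono2) auto
    also have "\<dots> = row_mass powr (r - 1) * j"
      using r j by (simp add: powr_powr)
    finally show ?case
      using int j by (simp add: ennreal_leI flip: ennreal_mult)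
  qed
  show "AE y in M. integrable X (\<lambda>z. \<sigma> z * coefficient f z * Q z y)"
    using pointwise by eventually_elim simp
  have "(\<integral>\<^sup>+y. norm (superposition f y) powr r \<partial>M) \<le> (\<integral>\<^sup>+y. ennreal (row_mass powr (r - 1)) * ?J y \<partial>M)"
    using pointwise by (intro nn_integral_mono_AE) (auto elim: eventually_mono)
  also have "\<dots> = ennreal (row_mass powr (r - 1)) * (\<integral>\<^sup>+y. ?J y \<partial>M)"
    by (rule nn_integral_cmult) measurable
  also have "\<dots> \<le> ennreal (row_mass powr (r - 1)) * (ennreal column_mass * ennreal (LINT x|M. norm (f x) powr r))"
    by (intro mult_left_mono J) simp
  also have "\<dots> = ennreal (row_mass powr (r - 1) * column_mass * (LINT x|M. norm (f x) powr r))"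
    by (simp add: column_mass_nonneg mult.assoc flip: ennreal_mult)
  finally show "(\<integral>\<^sup>+y. norm (superposition f y) powr r \<partial>M)
      \<le> ennreal (row_mass powr (r - 1) * column_mass * (LINT x|M. norm (f x) powr r))" .
qed

lemma superposition_integrable:
  assumes f: "f \<in> Lp_functions M p" and p: "1 \<le> p"
  shows "AE y in M. integrable X (\<lambda>z. \<sigma> z * coefficient f z * Q z y)"
proof (cases "p = \<infinity>")
  case True
  then show ?thesis
    using superposition_infinity f by (auto elim: eventually_mono)
next
  case False
  then have "1 \<le> enn2real p"
    using p by (cases p) auto
  then show ?thesis
    using superposition_finite(1)[of f "enn2real p"] f False by (simp add: Lp_functions_finite_iff)
qed

text \<open>
  With \<open>q\<close> conjugate to \<open>p\<close> this is \<open>row_mass powr (1 / q) * column_mass powr (1 / p)\<close>. The endpoint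
  \<open>p = \<infinity>\<close> is listed separately because there the second factor would be \<open>0 powr 0 = 0\<close> instead of \<open>1\<close>
  when \<open>column_mass\<close> vanishes.
\<close>

definition schur_bound :: "ennreal \<Rightarrow> real" where
  "schur_bound p = (if p = \<infinity> then row_mass
     else row_mass powr (1 - 1 / enn2real p) * column_mass powr (1 / enn2real p))"

lemma schur_bound_nonneg: "0 \<le> schur_bound p"
  by (simp add: schur_bound_def row_mass_nonneg)

lemma superposition_Lp:
  assumes f: "f \<in> Lp_functions M p" and p: "1 \<le> p"
  shows "superposition f \<in> Lp_functions M p"
    and "Lp_norm M p (superposition f) \<le> schur_bound p * Lp_norm M p f"
proof -
  note [measurable] = superposition_measurable[OF Lp_functions_measurable[OF f]]
  have "superposition f \<in> Lp_functions M p \<and>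
    Lp_norm M p (superposition f) \<le> schur_bound p * Lp_norm M p f"
  proof (cases "p = \<infinity>")
    case True
    have "AE y in M. norm (superposition f y) \<le> row_mass * Lp_norm M \<infinity> f"
      using superposition_infinity[OF f[unfolded True]] by eventually_elim simp
    then show ?thesis
      using Lp_functions_infinityI[of "superposition f" M] Lp_norm_infinity_le[of "superposition f" M]
      by (simp add: True schur_bound_def row_mass_nonneg Lp_norm_nonneg)
  next
    case False
    define r where "r = enn2real p"
    have r: "1 \<le> r"
      using p False unfolding r_def by (cases p) auto
    let ?I = "LINT x|M. norm (f x) powr r" and ?L = "LINT y|M. norm (superposition f y) powr r"
    let ?b = "row_mass powr (r - 1) * column_mass * ?I"
    have nn: "(\<integral>\<^sup>+y. norm (superposition f y) powr r \<partial>M) \<le> ennreal ?b"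
      using f False r by (intro superposition_finite(2)) (auto simp: Lp_functions_finite_iff r_def)
    then have int: "integrable M (\<lambda>y. norm (superposition f y) powr r)"
      by (intro integrableI_bounded) (auto intro: order_le_less_trans)
    have "ennreal ?L \<le> ennreal ?b"
      using nn int by (simp add: nn_integral_eq_integral)
    then have "?L \<le> ?b"
      by (simp add: column_mass_nonneg)
    then have "?L powr (1 / r) \<le> ?b powr (1 / r)"
      using r by (intro powr_mono2) auto
    also have "\<dots> = (row_mass powr (r - 1)) powr (1 / r) * column_mass powr (1 / r) * ?I powr (1 / r)"
      by (simp add: powr_mult column_mass_nonneg)
    also have "(row_mass powr (r - 1)) powr (1 / r) = row_mass powr (1 - 1 / r)"
      using r by (simp add: powr_powr diff_divide_distrib)
    finally show ?thesis
      using False int by (simp add: Lp_norm_def schur_bound_def Lp_functions_finite_iff r_def)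
  qed
  then show "superposition f \<in> Lp_functions M p"
    and "Lp_norm M p (superposition f) \<le> schur_bound p * Lp_norm M p f"
    by auto
qed

lemma coefficient_cong:
  assumes "f \<in> borel_measurable M" "g \<in> borel_measurable M" "AE x in M. f x = g x" "z \<in> space X"
  shows "coefficient f z = coefficient g z"
  unfolding coefficient_def
proof (rule integral_cong_AE)
  note [measurable] = assms(1,2) P_section[OF assms(4)]
  show "(\<lambda>y. f y * cnj (P z y)) \<in> borel_measurable M" "(\<lambda>y. g y * cnj (P z y)) \<in> borel_measurable M"
    by measurable
  show "AE y in M. f y * cnj (P z y) = g y * cnj (P z y)"
    using assms(3) by eventually_elim simp
qed

theorem superposition_operator:
  assumes p: "1 \<le> p"
  shows "\<exists>T. bounded_operator_Lp M p T \<and>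
             (\<forall>f\<in>Lp_functions M p. T (Lp_class M p f) = Lp_class M p (superposition f)) \<and>
             operator_norm_Lp M p T \<le> schur_bound p"
proof (rule bounded_operator_Lp_of_representatives)
  show "superposition f \<in> Lp_functions M p"
    and "Lp_norm M p (superposition f) \<le> schur_bound p * Lp_norm M p f"
    if "f \<in> Lp_functions M p" for f
    using superposition_Lp[OF that p] by auto
  show "AE x in M. superposition f x = superposition g x"
    if "f \<in> Lp_functions M p" "g \<in> Lp_functions M p" "AE x in M. f x = g x" for f g
  proof -
    have "coefficient f z = coefficient g z" if "z \<in> space X" for z
      using that \<open>AE x in M. f x = g x\<close> \<open>f \<in> _\<close> \<open>g \<in> _\<close> by (intro coefficient_cong Lp_functions_measurable)
    then show ?thesis
      unfolding superposition_def by (intro AE_I2 Bochner_Integration.integral_cong) auto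
  qed
  show "AE x in M. superposition (\<lambda>x. f x + g x) x = superposition f x + superposition g x"
    if f: "f \<in> Lp_functions M p" and g: "g \<in> Lp_functions M p" for f g
    using superposition_integrable[OF f p] superposition_integrable[OF g p]
  proof eventually_elim
    case (elim y)
    have "coefficient (\<lambda>x. f x + g x) z = coefficient f z + coefficient g z" if "z \<in> space X" for z
      using coefficient_integrable[OF f p that] coefficient_integrable[OF g p that]
      by (simp add: coefficient_def distrib_right)
    then have "superposition (\<lambda>x. f x + g x) y =
        (LINT z|X. \<sigma> z * coefficient f z * Q z y + \<sigma> z * coefficient g z * Q z y)"
      unfolding superposition_def
      by (intro Bochner_Integration.integral_cong) (auto simp: algebra_simps)
    then show ?case
      using elim by (simp add: superposition_def)
  qed
  show "AE x in M. superposition (\<lambda>x. k * f x) x = k * superposition f x" for k f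
  proof (rule AE_I2)
    fix y
    have "coefficient (\<lambda>x. k * f x) z = k * coefficient f z" for z
      by (simp add: coefficient_def mult.assoc)
    then have "superposition (\<lambda>x. k * f x) y = (LINT z|X. k * (\<sigma> z * coefficient f z * Q z y))"
      by (simp add: superposition_def mult_ac)
    then show "superposition (\<lambda>x. k * f x) y = k * superposition f y"
      by (simp add: superposition_def)
  qed
qed (rule schur_bound_nonneg)

end

section \<open>Polar coordinates in the half-plane\<close>

text \<open>
  Substitutions like \<open>- cot\<close> on \<open>{0<..<pi}\<close> are unbounded at the ends of the interval, so the theorem for
  compact intervals is applied to an exhaustion.
\<close>

lemma nn_integral_substitution_Ioo:
  fixes f :: "real \<Rightarrow> ennreal" and g g' :: "real \<Rightarrow> real"
  assumes f [measurable]: "f \<in> borel_measurable borel" and ab: "a < b"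
    and deriv: "\<And>x. x \<in> {a<..<b} \<Longrightarrow> (g has_real_derivative g' x) (at x)"
    and cont: "continuous_on {a<..<b} g'"
    and pos: "\<And>x. x \<in> {a<..<b} \<Longrightarrow> 0 < g' x"
  shows "(\<integral>\<^sup>+x. f x * indicator (g ` {a<..<b}) x \<partial>lborel) =
    (\<integral>\<^sup>+x. f (g x) * ennreal (g' x) * indicator {a<..<b} x \<partial>lborel)"
proof -
  \<comment> \<open>The summand \<open>3\<close> makes even the first of the compact intervals nondegenerate.\<close>
  define l where "l n = a + (b - a) / (real n + 3)" for n :: nat
  define u where "u n = b - (b - a) / (real n + 3)" for n :: nat
  have lu: "a < l n" "l n < u n" "u n < b" for n
  proof -
    have "(b - a) * 2 < (b - a) * (real n + 3)"
      using ab by (intro mult_strict_left_mono) auto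
    then have "(b - a) / (real n + 3) * 2 < b - a" "0 < (b - a) / (real n + 3)"
      using ab by (simp_all add: pos_divide_less_eq)
    then show "l n < u n" "a < l n" "u n < b"
      unfolding l_def u_def by linarith+
  qed
  have mono: "l n \<le> l m \<and> u m \<le> u n" if "m \<le> n" for m n
    using that ab by (auto simp: l_def u_def intro!: divide_left_mono)
  have Un: "{a<..<b} = (\<Union>n. {l n..u n})"
  proof
    show "{a<..<b} \<subseteq> (\<Union>n. {l n..u n})"
    proof
      fix x assume x: "x \<in> {a<..<b}"
      have lim: "(\<lambda>n. l n) \<longlonglongrightarrow> a + 0" "(\<lambda>n. u n) \<longlonglongrightarrow> b - 0"
        unfolding l_def u_def by real_asymp+
      have "\<forall>\<^sub>F n in sequentially. l n < x" "\<forall>\<^sub>F n in sequentially. x < u n"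
        using order_tendstoD(2)[OF lim(1), of x] order_tendstoD(1)[OF lim(2), of x] x by auto
      then have "\<forall>\<^sub>F n in sequentially. l n < x \<and> x < u n"
        by (rule eventually_conj)
      then obtain n where "l n < x \<and> x < u n"
        using eventually_happens by fastforce
      then have "x \<in> {l n..u n}" by simp
      then show "x \<in> (\<Union>n. {l n..u n})" by blast
    qed
    show "(\<Union>n. {l n..u n}) \<subseteq> {a<..<b}"
    proof
      fix x assume "x \<in> (\<Union>n. {l n..u n})"
      then obtain n where "x \<in> {l n..u n}" by blast
      then show "x \<in> {a<..<b}"
        using lu(1)[of n] lu(3)[of n] by simp
    qed
  qed
  have contg: "continuous_on {a<..<b} g"
    using deriv by (intro continuous_at_imp_continuous_on) (blast intro: DERIV_isCont)
  have strict: "g x < g y" if "x \<in> {a<..<b}" "y \<in> {a<..<b}" "x < y" for x y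
  proof (rule DERIV_pos_imp_increasing[OF \<open>x < y\<close>])
    show "\<exists>d. (g has_real_derivative d) (at t) \<and> 0 < d" if "x \<le> t" "t \<le> y" for t
      using deriv[of t] pos[of t] that \<open>x \<in> _\<close> \<open>y \<in> _\<close> by auto
  qed
  have img: "g ` {l n..u n} = {g (l n)..g (u n)}" for n
  proof -
    have sub: "{l n..u n} \<subseteq> {a<..<b}"
      using Un by blast
    have weak: "g x \<le> g y" if "x \<in> {l n..u n}" "y \<in> {l n..u n}" "x \<le> y" for x y
    proof (cases "x = y")
      case False
      moreover have "x \<in> {a<..<b}" "y \<in> {a<..<b}"
        using that sub by blast+
      ultimately show ?thesis
        using strict[of x y] that(3) by simp
    qed simp
    show ?thesis
    proof
      show "g ` {l n..u n} \<subseteq> {g (l n)..g (u n)}"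
        using lu(2)[of n] by (auto intro!: weak)
      show "{g (l n)..g (u n)} \<subseteq> g ` {l n..u n}"
      proof
        fix y assume "y \<in> {g (l n)..g (u n)}"
        then have "\<exists>x\<ge>l n. x \<le> u n \<and> g x = y"
          using lu(2)[of n] continuous_on_subset[OF contg sub] by (intro IVT') auto
        then show "y \<in> g ` {l n..u n}" by auto
      qed
    qed
  qed
  let ?h = "\<lambda>x. f (indicator {a<..<b} x * g x) * ennreal (indicator {a<..<b} x * g' x)"
  have [measurable]: "(\<lambda>x. indicator {a<..<b} x * g x) \<in> borel_measurable borel"
      "(\<lambda>x. indicator {a<..<b} x * g' x) \<in> borel_measurable borel"
    using borel_measurable_continuous_on_indicator[OF _ contg] borel_measurable_continuous_on_indicator[OF _ cont]
    by simp_all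
  have piece: "(\<integral>\<^sup>+x. f x * indicator (g ` {l n..u n}) x \<partial>lborel) =
    (\<integral>\<^sup>+x. ?h x * indicator {l n..u n} x \<partial>lborel)" for n
  proof -
    have sub: "{l n..u n} \<subseteq> {a<..<b}"
      using Un by blast
    have "(\<integral>\<^sup>+x. f x * indicator (g ` {l n..u n}) x \<partial>lborel) =
      (\<integral>\<^sup>+x. f (g x) * ennreal (g' x) * indicator {l n..u n} x \<partial>lborel)"
      unfolding img using lu(2) sub continuous_on_subset[OF cont sub] pos deriv
      by (intro nn_integral_substitution_aux) (auto simp: less_imp_le subset_iff)
    also have "\<dots> = (\<integral>\<^sup>+x. ?h x * indicator {l n..u n} x \<partial>lborel)"
      using sub by (intro nn_integral_cong) (auto simp: indicator_def)
    finally show ?thesis .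
  qed
  have exhaust: "(\<integral>\<^sup>+x. k x * indicator (\<Union>n. A n) x \<partial>lborel) = (SUP n. \<integral>\<^sup>+x. k x * indicator (A n) x \<partial>lborel)"
    if [measurable]: "k \<in> borel_measurable borel" and A: "\<And>n. A n \<in> sets borel" "incseq A"
    for k :: "real \<Rightarrow> ennreal" and A :: "nat \<Rightarrow> real set"
  proof -
    have "(SUP n. emeasure (density lborel k) (A n)) = emeasure (density lborel k) (\<Union>n. A n)"
      using A by (intro SUP_emeasure_incseq) auto
    then show ?thesis
      using A by (simp add: emeasure_density)
  qed
  have inc: "incseq (\<lambda>n. {l n..u n})"
    using mono by (intro incseq_SucI) (metis Suc_n_not_le_n atLeastatMost_subset_iff nat_le_linear)
  have "(\<integral>\<^sup>+x. f x * indicator (g ` {a<..<b}) x \<partial>lborel) =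
      (\<integral>\<^sup>+x. f x * indicator (\<Union>n. g ` {l n..u n}) x \<partial>lborel)"
    by (simp add: Un image_UN)
  also have "\<dots> = (SUP n. \<integral>\<^sup>+x. f x * indicator (g ` {l n..u n}) x \<partial>lborel)"
  proof (rule exhaust)
    show "incseq (\<lambda>n. g ` {l n..u n})"
      using inc unfolding incseq_def by (meson image_mono)
  qed (use img in auto)
  also have "\<dots> = (SUP n. \<integral>\<^sup>+x. ?h x * indicator {l n..u n} x \<partial>lborel)"
    by (simp only: piece)
  also have "\<dots> = (\<integral>\<^sup>+x. ?h x * indicator (\<Union>n. {l n..u n}) x \<partial>lborel)"
    by (rule exhaust[symmetric]) (use inc in auto)
  also have "\<dots> = (\<integral>\<^sup>+x. f (g x) * ennreal (g' x) * indicator {a<..<b} x \<partial>lborel)"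
    unfolding Un[symmetric] by (intro nn_integral_cong) (auto simp: indicator_def)
  finally show ?thesis .
qed

text \<open>
  Polar coordinates by one-dimensional substitutions only: on the horizontal line at height \<open>b\<close> the
  abscissa is \<open>b cot \<theta>\<close>, and after exchanging the integrals, on each ray the height is
  \<open>s sin \<theta>\<close>. The Jacobians \<open>b\<close>, \<open>1 / sin\<^sup>2 \<theta>\<close> and \<open>sin \<theta>\<close> multiply to \<open>s\<close>.
\<close>

lemma nn_integral_half_plane_polar:
  fixes h :: "real \<times> real \<Rightarrow> ennreal"
  assumes [measurable]: "h \<in> borel_measurable borel"
  shows "(\<integral>\<^sup>+b. (\<integral>\<^sup>+a. h (a, b) \<partial>lborel) * indicator {0<..} b \<partial>lborel) =
    (\<integral>\<^sup>+\<theta>. (\<integral>\<^sup>+s. h (s * cos \<theta>, s * sin \<theta>) * ennreal s * indicator {0<..} s \<partial>lborel)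
        * indicator {0<..<pi} \<theta> \<partial>lborel)"
proof -
  define F where "F t = (\<integral>\<^sup>+b. h (- b * t, b) * ennreal b * indicator {0<..} b \<partial>lborel)" for t
  have [measurable]: "F \<in> borel_measurable borel"
    unfolding F_def by measurable
  have "(\<integral>\<^sup>+b. (\<integral>\<^sup>+a. h (a, b) \<partial>lborel) * indicator {0<..} b \<partial>lborel) =
      (\<integral>\<^sup>+b. (\<integral>\<^sup>+t. h (- b * t, b) * ennreal b * indicator {0<..} b \<partial>lborel) \<partial>lborel)"
  proof (rule nn_integral_cong)
    fix b :: real
    show "(\<integral>\<^sup>+a. h (a, b) \<partial>lborel) * indicator {0<..} b =
        (\<integral>\<^sup>+t. h (- b * t, b) * ennreal b * indicator {0<..} b \<partial>lborel)"
    proof (cases "0 < b")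
      case True
      have "(\<integral>\<^sup>+a. h (a, b) \<partial>lborel) = ennreal \<bar>- b\<bar> * (\<integral>\<^sup>+t. h (0 + - b * t, b) \<partial>lborel)"
        using True by (intro nn_integral_real_affine) auto
      also have "\<dots> = (\<integral>\<^sup>+t. h (- b * t, b) * ennreal b \<partial>lborel)"
        using True by (subst nn_integral_multc) (auto simp: mult.commute)
      finally show ?thesis
        using True by simp
    qed simp
  qed
  also have "\<dots> = (\<integral>\<^sup>+t. F t \<partial>lborel)"
    unfolding F_def by (rule lborel_pair.Fubini') measurable
  also have "\<dots> = (\<integral>\<^sup>+t. F t * indicator ((\<lambda>\<theta>. - cot \<theta>) ` {0<..<pi}) t \<partial>lborel)"
  proof -
    have "t \<in> (\<lambda>\<theta>. - cot \<theta>) ` {0<..<pi}" for t :: real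
    proof (rule image_eqI)
      have "cot (pi / 2 + arctan t) = tan (pi / 2 - (pi / 2 + arctan t))"
        by (simp only: tan_cot')
      then show "t = - cot (pi / 2 + arctan t)"
        by (simp add: tan_arctan)
      show "pi / 2 + arctan t \<in> {0<..<pi}"
        using arctan_bounded[of t] by auto
    qed
    then have "(\<lambda>\<theta>. - cot \<theta>) ` {0<..<pi} = (UNIV :: real set)"
      by blast
    then show ?thesis by simp
  qed
  also have "\<dots> = (\<integral>\<^sup>+\<theta>. F (- cot \<theta>) * ennreal (inverse ((sin \<theta>)\<^sup>2)) * indicator {0<..<pi} \<theta> \<partial>lborel)"
  proof (rule nn_integral_substitution_Ioo)
    have sin: "sin x \<noteq> 0" if "x \<in> {0<..<pi}" for x :: real
      using that sin_gt_zero[of x] by auto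
    show "((\<lambda>\<theta>. - cot \<theta>) has_real_derivative inverse ((sin x)\<^sup>2)) (at x)" if "x \<in> {0<..<pi}" for x
      using DERIV_minus[OF DERIV_cot[OF sin[OF that]]] by simp
    show "continuous_on {0<..<pi} (\<lambda>x :: real. inverse ((sin x)\<^sup>2))"
      using sin by (intro continuous_intros) auto
    show "0 < inverse ((sin x)\<^sup>2)" if "x \<in> {0<..<pi}" for x :: real
      using sin[OF that] by simp
  qed auto
  also have "\<dots> = (\<integral>\<^sup>+\<theta>. (\<integral>\<^sup>+s. h (s * cos \<theta>, s * sin \<theta>) * ennreal s * indicator {0<..} s \<partial>lborel)
        * indicator {0<..<pi} \<theta> \<partial>lborel)"
  proof (rule nn_integral_cong)
    fix \<theta> :: real
    show "F (- cot \<theta>) * ennreal (inverse ((sin \<theta>)\<^sup>2)) * indicator {0<..<pi} \<theta> =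
        (\<integral>\<^sup>+s. h (s * cos \<theta>, s * sin \<theta>) * ennreal s * indicator {0<..} s \<partial>lborel) * indicator {0<..<pi} \<theta>"
    proof (cases "\<theta> \<in> {0<..<pi}")
      case True
      then have sin: "0 < sin \<theta>" using sin_gt_zero by auto
      have "F (- cot \<theta>) = ennreal \<bar>sin \<theta>\<bar> *
          (\<integral>\<^sup>+s. h (- (0 + sin \<theta> * s) * - cot \<theta>, 0 + sin \<theta> * s) * ennreal (0 + sin \<theta> * s)
             * indicator {0<..} (0 + sin \<theta> * s) \<partial>lborel)"
        unfolding F_def using sin by (intro nn_integral_real_affine) auto
      also have "\<dots> = ennreal (sin \<theta>) *
          (\<integral>\<^sup>+s. ennreal (sin \<theta>) * (h (s * cos \<theta>, s * sin \<theta>) * ennreal s * indicator {0<..} s) \<partial>lborel)"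
      proof -
        have "h (- (0 + sin \<theta> * s) * - cot \<theta>, 0 + sin \<theta> * s) * ennreal (0 + sin \<theta> * s)
             * indicator {0<..} (0 + sin \<theta> * s) =
           ennreal (sin \<theta>) * (h (s * cos \<theta>, s * sin \<theta>) * ennreal s * indicator {0<..} s)" for s
        proof (cases "0 < s")
          case True
          have "sin \<theta> * s * cot \<theta> = s * cos \<theta>"
            using sin by (simp add: cot_def)
          with True sin show ?thesis
            by (simp add: ennreal_mult mult_ac)
        next
          case False
          with sin show ?thesis
            by (simp add: indicator_def zero_less_mult_iff)
        qed
        then show ?thesis using sin by simp
      qed
      also have "\<dots> = ennreal ((sin \<theta>)\<^sup>2) *
          (\<integral>\<^sup>+s. h (s * cos \<theta>, s * sin \<theta>) * ennreal s * indicator {0<..} s \<partial>lborel)"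
        using sin by (subst nn_integral_cmult) (auto simp: power2_eq_square ennreal_mult mult_ac)
      finally have "F (- cot \<theta>) * ennreal (inverse ((sin \<theta>)\<^sup>2)) =
          ennreal ((sin \<theta>)\<^sup>2 * inverse ((sin \<theta>)\<^sup>2)) *
          (\<integral>\<^sup>+s. h (s * cos \<theta>, s * sin \<theta>) * ennreal s * indicator {0<..} s \<partial>lborel)"
        by (subst ennreal_mult) (auto simp: mult_ac)
      with sin True show ?thesis by simp
    qed simp
  qed
  finally show ?thesis .
qed

text \<open>
  The Bessel translation preserves \<open>s powr (2 * \<alpha> + 1) ds\<close> up to the total mass of the angular weight:
  in the Cartesian coordinates \<open>(a, b)\<close> of the point with polar coordinates \<open>(s, \<theta>)\<close>, the argument of \<open>G\<close>
  is the distance to \<open>(- r, 0)\<close>. So the integrand is a radial function shifted horizontally, and the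
  weight \<open>b powr (2 * \<alpha>)\<close> depends on the height only.
\<close>

lemma nn_integral_Bessel_translation:
  fixes G :: "real \<Rightarrow> ennreal" and r \<alpha> :: real
  assumes [measurable]: "G \<in> borel_measurable borel"
  shows "(\<integral>\<^sup>+s. (\<integral>\<^sup>+\<theta>. G (sqrt (r\<^sup>2 + s\<^sup>2 + 2 * r * s * cos \<theta>)) * ennreal (sin \<theta> powr (2 * \<alpha>)) * indicator {0<..<pi} \<theta> \<partial>lborel)
      * (ennreal (s powr (2 * \<alpha> + 1)) * indicator {0<..} s) \<partial>lborel) =
    (\<integral>\<^sup>+\<theta>. ennreal (sin \<theta> powr (2 * \<alpha>)) * indicator {0<..<pi} \<theta> \<partial>lborel) *
    (\<integral>\<^sup>+s. G s * (ennreal (s powr (2 * \<alpha> + 1)) * indicator {0<..} s) \<partial>lborel)"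
proof -
  define h where "h r = (\<lambda>(a, b). G (sqrt ((r + a)\<^sup>2 + b\<^sup>2)) * ennreal (b powr (2 * \<alpha>)))" for r :: real
  have [measurable]: "h r \<in> borel_measurable borel" for r
    unfolding h_def borel_prod[symmetric] by measurable
  have polar: "(\<integral>\<^sup>+b. (\<integral>\<^sup>+a. h r (a, b) \<partial>lborel) * indicator {0<..} b \<partial>lborel) =
     (\<integral>\<^sup>+\<theta>. \<integral>\<^sup>+s. G (sqrt (r\<^sup>2 + s\<^sup>2 + 2 * r * s * cos \<theta>)) * ennreal (sin \<theta> powr (2 * \<alpha>)) * indicator {0<..<pi} \<theta>
         * (ennreal (s powr (2 * \<alpha> + 1)) * indicator {0<..} s) \<partial>lborel \<partial>lborel)" for r
  proof -
    have "(\<integral>\<^sup>+s. h r (s * cos \<theta>, s * sin \<theta>) * ennreal s * indicator {0<..} s \<partial>lborel) * indicator {0<..<pi} \<theta> =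
      (\<integral>\<^sup>+s. G (sqrt (r\<^sup>2 + s\<^sup>2 + 2 * r * s * cos \<theta>)) * ennreal (sin \<theta> powr (2 * \<alpha>)) * indicator {0<..<pi} \<theta>
         * (ennreal (s powr (2 * \<alpha> + 1)) * indicator {0<..} s) \<partial>lborel)" for \<theta>
    proof (cases "\<theta> \<in> {0<..<pi}")
      case True
      then have sin: "0 < sin \<theta>" using sin_gt_zero by auto
      have "h r (s * cos \<theta>, s * sin \<theta>) * ennreal s =
        G (sqrt (r\<^sup>2 + s\<^sup>2 + 2 * r * s * cos \<theta>)) * ennreal (sin \<theta> powr (2 * \<alpha>)) * ennreal (s powr (2 * \<alpha> + 1))"
        if s: "0 < s" for s
      proof -
        have "(r + s * c)\<^sup>2 + (s * d)\<^sup>2 = r\<^sup>2 + s\<^sup>2 * (d\<^sup>2 + c\<^sup>2) + 2 * r * s * c" for c d :: real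
          by algebra
        from this[of "cos \<theta>" "sin \<theta>"] have "(r + s * cos \<theta>)\<^sup>2 + (s * sin \<theta>)\<^sup>2 = r\<^sup>2 + s\<^sup>2 + 2 * r * s * cos \<theta>"
          by simp
        moreover have "(s * sin \<theta>) powr (2 * \<alpha>) * s = sin \<theta> powr (2 * \<alpha>) * s powr (2 * \<alpha> + 1)"
          using s sin by (simp add: powr_mult powr_add)
        ultimately show ?thesis
          using s by (simp add: h_def mult.assoc flip: ennreal_mult)
      qed
      then show ?thesis
        using True by (auto intro!: nn_integral_cong simp: indicator_def)
    qed simp
    then show ?thesis
      by (subst nn_integral_half_plane_polar) simp_all
  qed
  have shift: "(\<integral>\<^sup>+a. h r (a, b) \<partial>lborel) = (\<integral>\<^sup>+a. h 0 (a, b) \<partial>lborel)" for b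
    using nn_integral_real_affine[of "\<lambda>a. h 0 (a, b)" 1 r] by (simp add: h_def)
  have "(\<integral>\<^sup>+s. (\<integral>\<^sup>+\<theta>. G (sqrt (r\<^sup>2 + s\<^sup>2 + 2 * r * s * cos \<theta>)) * ennreal (sin \<theta> powr (2 * \<alpha>)) * indicator {0<..<pi} \<theta> \<partial>lborel)
      * (ennreal (s powr (2 * \<alpha> + 1)) * indicator {0<..} s) \<partial>lborel) =
    (\<integral>\<^sup>+s. \<integral>\<^sup>+\<theta>. G (sqrt (r\<^sup>2 + s\<^sup>2 + 2 * r * s * cos \<theta>)) * ennreal (sin \<theta> powr (2 * \<alpha>)) * indicator {0<..<pi} \<theta>
         * (ennreal (s powr (2 * \<alpha> + 1)) * indicator {0<..} s) \<partial>lborel \<partial>lborel)"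
    by (intro nn_integral_cong nn_integral_multc[symmetric]) measurable
  also have "\<dots> = (\<integral>\<^sup>+\<theta>. \<integral>\<^sup>+s. G (sqrt (r\<^sup>2 + s\<^sup>2 + 2 * r * s * cos \<theta>)) * ennreal (sin \<theta> powr (2 * \<alpha>)) * indicator {0<..<pi} \<theta>
         * (ennreal (s powr (2 * \<alpha> + 1)) * indicator {0<..} s) \<partial>lborel \<partial>lborel)"
    by (rule lborel_pair.Fubini') measurable
  also have "\<dots> = (\<integral>\<^sup>+\<theta>. \<integral>\<^sup>+s. G (sqrt (0\<^sup>2 + s\<^sup>2 + 2 * 0 * s * cos \<theta>)) * ennreal (sin \<theta> powr (2 * \<alpha>)) * indicator {0<..<pi} \<theta>
         * (ennreal (s powr (2 * \<alpha> + 1)) * indicator {0<..} s) \<partial>lborel \<partial>lborel)"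
    unfolding polar[symmetric] by (simp only: shift)
  also have "\<dots> = (\<integral>\<^sup>+\<theta>. \<integral>\<^sup>+s. ennreal (sin \<theta> powr (2 * \<alpha>)) * indicator {0<..<pi} \<theta>
         * (G s * (ennreal (s powr (2 * \<alpha> + 1)) * indicator {0<..} s)) \<partial>lborel \<partial>lborel)"
    by (intro nn_integral_cong) (auto simp: indicator_def mult_ac)
  also have "\<dots> = (\<integral>\<^sup>+\<theta>. ennreal (sin \<theta> powr (2 * \<alpha>)) * indicator {0<..<pi} \<theta> \<partial>lborel) *
    (\<integral>\<^sup>+s. G s * (ennreal (s powr (2 * \<alpha> + 1)) * indicator {0<..} s) \<partial>lborel)"
    by (simp add: nn_integral_cmult nn_integral_multc)
  finally show ?thesis .
qed

section \<open>The total mass of the angular weight\<close>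

lemma Gamma_legendre_duplication_real:
  fixes z :: real
  assumes "0 < z"
  shows "Gamma z * Gamma (z + 1 / 2) = 2 powr (1 - 2 * z) * sqrt pi * Gamma (2 * z)"
proof -
  have *: "Gamma (complex_of_real x) = of_real (Gamma x)" for x
    by (rule Gamma_complex_of_real)
  have "complex_of_real z \<notin> \<int>\<^sub>\<le>\<^sub>0" "complex_of_real z + 1 / 2 \<notin> \<int>\<^sub>\<le>\<^sub>0"
    using assms by (auto elim!: nonpos_Ints_cases simp: complex_eq_iff)
  note dup = Gamma_legendre_duplication[OF this]
  have e: "complex_of_real z + 1 / 2 = of_real (z + 1 / 2)"
      "(1 - complex_of_real (2 * z)) * of_real (ln 2) = of_real ((1 - 2 * z) * ln 2)"
      "2 * complex_of_real z = of_real (2 * z)"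
    by simp_all
  have "Gamma z * Gamma (z + 1 / 2) = exp ((1 - 2 * z) * ln 2) * sqrt pi * Gamma (2 * z)"
    using dup unfolding e * exp_of_real of_real_mult[symmetric] of_real_eq_iff .
  then show ?thesis
    by (simp add: powr_def)
qed

text \<open>
  The reciprocal of the normalizing constant of the generalized translation.
\<close>

definition angular_mass :: "real \<Rightarrow> real" where
  "angular_mass \<alpha> = sqrt pi * Gamma (\<alpha> + 1 / 2) / Gamma (\<alpha> + 1)"

lemma angular_mass_pos: "- 1 / 2 < \<alpha> \<Longrightarrow> 0 < angular_mass \<alpha>"
  by (simp add: angular_mass_def Gamma_real_pos)

text \<open>The substitution \<open>u = sin\<^sup>2 (\<theta> / 2)\<close> turns the integral into a Beta integral.\<close>

lemma nn_integral_sin_powr: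
  assumes \<alpha>: "- 1 / 2 < \<alpha>"
  shows "(\<integral>\<^sup>+\<theta>. ennreal (sin \<theta> powr (2 * \<alpha>)) * indicator {0<..<pi} \<theta> \<partial>lborel) = ennreal (angular_mass \<alpha>)"
proof -
  let ?b = "\<lambda>u. u powr (\<alpha> + 1 / 2 - 1) * (1 - u) powr (\<alpha> + 1 / 2 - 1) :: real"
  let ?g = "\<lambda>\<theta>. (1 - cos \<theta>) / 2 :: real"
  let ?f = "\<lambda>u. ennreal (2 powr (2 * \<alpha>)) * ennreal (?b u)"
  have img: "?g ` {0<..<pi} = {0<..<1}"
  proof
    show "?g ` {0<..<pi} \<subseteq> {0<..<1}"
    proof
      fix u assume "u \<in> ?g ` {0<..<pi}"
      then obtain t where t: "0 < t" "t < pi" "u = ?g t" by auto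
      then show "u \<in> {0<..<1}"
        using cos_monotone_0_pi[of 0 t] cos_monotone_0_pi[of t pi] by auto
    qed
    show "{0<..<1} \<subseteq> ?g ` {0<..<pi}"
    proof
      fix u :: real assume u: "u \<in> {0<..<1}"
      then have "u = ?g (arccos (1 - 2 * u))" by simp
      moreover have "arccos (1 - 2 * u) \<in> {0<..<pi}"
        using u arccos_lt_bounded[of "1 - 2 * u"] by simp
      ultimately show "u \<in> ?g ` {0<..<pi}" by (rule image_eqI)
    qed
  qed
  have "(\<integral>\<^sup>+\<theta>. ennreal (sin \<theta> powr (2 * \<alpha>)) * indicator {0<..<pi} \<theta> \<partial>lborel) =
      (\<integral>\<^sup>+\<theta>. ?f (?g \<theta>) * ennreal (sin \<theta> / 2) * indicator {0<..<pi} \<theta> \<partial>lborel)"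
  proof (rule nn_integral_cong)
    fix \<theta> :: real
    show "ennreal (sin \<theta> powr (2 * \<alpha>)) * indicator {0<..<pi} \<theta> =
        ?f (?g \<theta>) * ennreal (sin \<theta> / 2) * indicator {0<..<pi} \<theta>"
    proof (cases "\<theta> \<in> {0<..<pi}")
      case True
      then have sin: "0 < sin \<theta>" using sin_gt_zero by auto
      have "?b (?g \<theta>) = (?g \<theta> * (1 - ?g \<theta>)) powr (\<alpha> + 1 / 2 - 1)"
        by (simp only: powr_mult)
      also have "?g \<theta> * (1 - ?g \<theta>) = (1 - (cos \<theta>)\<^sup>2) / 4"
        by (simp add: field_simps power2_eq_square)
      also have "\<dots> = (sin \<theta> / 2) powr 2"
        using sin by (simp add: sin_squared_eq power_divide)
      also have "\<dots> powr (\<alpha> + 1 / 2 - 1) = (sin \<theta> / 2) powr (2 * \<alpha> - 1)"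
        by (simp add: powr_powr algebra_simps)
      finally have "2 powr (2 * \<alpha>) * ?b (?g \<theta>) * (sin \<theta> / 2) = sin \<theta> powr (2 * \<alpha>)"
        using sin by (simp add: powr_diff powr_divide)
      then show ?thesis
        using True sin by (simp flip: ennreal_mult)
    qed simp
  qed
  also have "\<dots> = (\<integral>\<^sup>+u. ?f u * indicator (?g ` {0<..<pi}) u \<partial>lborel)"
  proof (rule nn_integral_substitution_Ioo[symmetric])
    show "(?g has_real_derivative sin x / 2) (at x)" for x
      by (auto intro!: derivative_eq_intros)
    show "continuous_on {0<..<pi} (\<lambda>x :: real. sin x / 2)"
      by (intro continuous_intros) auto
    show "0 < sin x / 2" if "x \<in> {0<..<pi}" for x :: real
      using that sin_gt_zero by auto
  qed auto
  also have "\<dots> = ennreal (2 powr (2 * \<alpha>)) * (\<integral>\<^sup>+u. ennreal (?b u) * indicator {0<..<1} u \<partial>lborel)"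
    unfolding img by (simp add: mult.assoc nn_integral_cmult)
  also have "(\<integral>\<^sup>+u. ennreal (?b u) * indicator {0<..<1} u \<partial>lborel) = ennreal (Beta (\<alpha> + 1 / 2) (\<alpha> + 1 / 2))"
    using has_integral_Beta_real[of "\<alpha> + 1 / 2" "\<alpha> + 1 / 2"] \<alpha>
    by (intro nn_integral_has_integral_lebesgue') (auto simp: has_integral_Icc_iff_Ioo)
  also have "ennreal (2 powr (2 * \<alpha>)) * ennreal (Beta (\<alpha> + 1 / 2) (\<alpha> + 1 / 2)) =
      ennreal (2 powr (2 * \<alpha>) * Beta (\<alpha> + 1 / 2) (\<alpha> + 1 / 2))"
    by (simp add: ennreal_mult')
  also have "2 powr (2 * \<alpha>) * Beta (\<alpha> + 1 / 2) (\<alpha> + 1 / 2) = angular_mass \<alpha>"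
  proof -
    have pos: "0 < Gamma (\<alpha> + 1 / 2)" "0 < Gamma (\<alpha> + 1)" "0 < Gamma (2 * \<alpha> + 1)"
      using \<alpha> by (auto intro!: Gamma_real_pos)
    have "Gamma (\<alpha> + 1 / 2) * Gamma (\<alpha> + 1) = 2 powr (- (2 * \<alpha>)) * sqrt pi * Gamma (2 * \<alpha> + 1)"
      using Gamma_legendre_duplication_real[of "\<alpha> + 1 / 2"] \<alpha> by (simp add: algebra_simps)
    then have "2 powr (2 * \<alpha>) * (Gamma (\<alpha> + 1 / 2) * Gamma (\<alpha> + 1)) = sqrt pi * Gamma (2 * \<alpha> + 1)"
      by (simp add: powr_minus)
    moreover have "2 powr (2 * \<alpha>) * (Gamma (\<alpha> + 1 / 2) * Gamma (\<alpha> + 1 / 2) / Gamma (2 * \<alpha> + 1)) =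
        2 powr (2 * \<alpha>) * (Gamma (\<alpha> + 1 / 2) * Gamma (\<alpha> + 1)) *
          (Gamma (\<alpha> + 1 / 2) / (Gamma (\<alpha> + 1) * Gamma (2 * \<alpha> + 1)))"
      using pos by (simp only: times_divide_eq_right) (simp add: less_imp_neq)
    ultimately show ?thesis
      using pos by (simp add: Beta_def angular_mass_def)
  qed
  finally show ?thesis .
qed

section \<open>The Weinstein measure under translation and dilation\<close>

definition weinstein_constant :: "'n::finite itself \<Rightarrow> real \<Rightarrow> real" where
  "weinstein_constant _ \<alpha> = (2 * pi) ^ CARD('n) * 2 powr (2 * \<alpha>) * (Gamma (\<alpha> + 1))\<^sup>2"

lemma weinstein_constant_nonneg [simp]: "0 \<le> weinstein_constant N \<alpha>"
  by (simp add: weinstein_constant_def)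

lemma half_space_borel [measurable]: "half_space \<in> sets borel"
  unfolding half_space_def by (intro borel_open open_Collect_less continuous_intros)

lemma space_weinstein_measure: "space (weinstein_measure \<alpha>) = half_space"
  by (simp add: weinstein_measure_def space_restrict_space)

lemma sets_weinstein_measure: "sets (weinstein_measure \<alpha>) = sets (restrict_space borel half_space)"
  by (simp add: weinstein_measure_def sets_restrict_space)

lemma measurable_weinstein_id: "(\<lambda>x. x) \<in> measurable (weinstein_measure \<alpha>) borel"
  unfolding measurable_cong_sets[OF sets_weinstein_measure refl]
  by (rule measurable_restrict_space1) simp

lemma borel_measurable_weinstein:
  "g \<in> borel_measurable borel \<Longrightarrow> g \<in> borel_measurable (weinstein_measure \<alpha>)"
  by (rule measurable_compose[OF measurable_weinstein_id])

lemma nn_integral_weinstein: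
  fixes g :: "(real ^ 'n) \<times> real \<Rightarrow> ennreal"
  assumes [measurable]: "g \<in> borel_measurable borel"
  shows "(\<integral>\<^sup>+x. g x \<partial>weinstein_measure \<alpha>) =
    (\<integral>\<^sup>+x. g x * (ennreal (snd x powr (2 * \<alpha> + 1)) * indicator {0<..} (snd x)) \<partial>lborel)
      * ennreal (1 / weinstein_constant TYPE('n) \<alpha>)"
proof -
  have [measurable]: "snd \<in> borel_measurable (borel :: ((real ^ 'n) \<times> real) measure)"
    by (simp add: borel_prod[symmetric])
  have [measurable]: "f \<in> borel_measurable (restrict_space lborel half_space)"
    if "f \<in> borel_measurable borel" for f :: "(real ^ 'n) \<times> real \<Rightarrow> ennreal"
    using that by (intro measurable_restrict_space1) simp
  have "(\<integral>\<^sup>+x. g x \<partial>weinstein_measure \<alpha>) =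
      (\<integral>\<^sup>+x. ennreal (snd x powr (2 * \<alpha> + 1) / weinstein_constant TYPE('n) \<alpha>) * g x
        \<partial>restrict_space lborel half_space)"
    unfolding weinstein_measure_def weinstein_constant_def by (rule nn_integral_density) measurable
  also have "\<dots> = (\<integral>\<^sup>+x. ennreal (snd x powr (2 * \<alpha> + 1) / weinstein_constant TYPE('n) \<alpha>) * g x
        * indicator half_space x \<partial>lborel)"
    by (rule nn_integral_restrict_space) simp
  also have "\<dots> = (\<integral>\<^sup>+x. g x * (ennreal (snd x powr (2 * \<alpha> + 1)) * indicator {0<..} (snd x))
      * ennreal (1 / weinstein_constant TYPE('n) \<alpha>) \<partial>lborel)"
    by (intro nn_integral_cong)
       (auto simp: half_space_def indicator_def divide_inverse ennreal_mult' mult_ac)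
  also have "\<dots> = (\<integral>\<^sup>+x. g x * (ennreal (snd x powr (2 * \<alpha> + 1)) * indicator {0<..} (snd x)) \<partial>lborel)
      * ennreal (1 / weinstein_constant TYPE('n) \<alpha>)"
    by (rule nn_integral_multc) measurable
  finally show ?thesis .
qed

lemma nn_integral_lborel_pair:
  fixes g :: "'a::euclidean_space \<times> 'b::euclidean_space \<Rightarrow> ennreal"
  assumes "g \<in> borel_measurable borel"
  shows "(\<integral>\<^sup>+x. g x \<partial>lborel) = (\<integral>\<^sup>+y. \<integral>\<^sup>+s. g (y, s) \<partial>lborel \<partial>lborel)"
  using assms by (subst lborel_prod[symmetric], subst lborel.nn_integral_fst[symmetric])
    (auto simp: lborel_prod)

definition translated_point :: "(real ^ 'n) \<times> real \<Rightarrow> (real ^ 'n) \<times> real \<Rightarrow> real \<Rightarrow> (real ^ 'n) \<times> real" where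
  "translated_point x y \<theta> =
     (fst x + fst y, sqrt ((snd x)\<^sup>2 + (snd y)\<^sup>2 + 2 * snd x * snd y * cos \<theta>))"

lemma translated_point_half_space:
  assumes "x \<in> half_space" "y \<in> half_space" "\<theta> \<in> {0<..<pi}"
  shows "translated_point x y \<theta> \<in> half_space"
proof -
  have "- 1 < cos \<theta>"
    using assms cos_monotone_0_pi[of \<theta> pi] by simp
  then have "2 * snd x * snd y * - 1 < 2 * snd x * snd y * cos \<theta>"
    using assms by (intro mult_strict_left_mono) (auto simp: half_space_def)
  moreover have "0 \<le> (snd x - snd y)\<^sup>2"
    by simp
  ultimately have "0 < (snd x)\<^sup>2 + (snd y)\<^sup>2 + 2 * snd x * snd y * cos \<theta>"
    by (simp add: power2_diff)
  then show ?thesis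
    by (simp add: translated_point_def half_space_def)
qed

lemma translated_point_measurable:
  fixes X Y :: "'b \<Rightarrow> (real ^ 'n) \<times> real" and T :: "'b \<Rightarrow> real"
  assumes [measurable]: "X \<in> measurable N borel" "Y \<in> measurable N borel" "T \<in> measurable N borel"
  shows "(\<lambda>u. translated_point (X u) (Y u) (T u)) \<in> measurable N borel"
proof -
  have [measurable]: "(\<lambda>u. fst (Z u)) \<in> measurable N borel" "(\<lambda>u. snd (Z u)) \<in> measurable N borel"
    if "Z \<in> measurable N borel" for Z :: "'b \<Rightarrow> (real ^ 'n) \<times> real"
    using that by (auto intro: measurable_compose[OF _ measurable_fst] measurable_compose[OF _ measurable_snd] simp: borel_prod[symmetric])
  show ?thesis
    unfolding translated_point_def by (intro borel_measurable_Pair) measurable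
qed

text \<open>
  The generalized translation is an ordinary translation in the first \<open>d\<close> coordinates and a Bessel
  translation in the last one, so it preserves the Weinstein integral up to the angular mass.
\<close>

lemma nn_integral_translated_point:
  fixes g :: "(real ^ 'n) \<times> real \<Rightarrow> ennreal"
  assumes g [measurable]: "g \<in> borel_measurable borel" and \<alpha>: "- 1 / 2 < \<alpha>"
  shows "(\<integral>\<^sup>+y. (\<integral>\<^sup>+\<theta>. g (translated_point x y \<theta>) * ennreal (sin \<theta> powr (2 * \<alpha>)) * indicator {0<..<pi} \<theta> \<partial>lborel)
      \<partial>weinstein_measure \<alpha>) =
    ennreal (angular_mass \<alpha>) * (\<integral>\<^sup>+y. g y \<partial>weinstein_measure \<alpha>)"
proof -
  let ?w = "\<lambda>s. ennreal (s powr (2 * \<alpha> + 1)) * indicator {0<..} s"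
  let ?G = "\<lambda>y. \<integral>\<^sup>+\<theta>. g (translated_point x y \<theta>) * ennreal (sin \<theta> powr (2 * \<alpha>)) * indicator {0<..<pi} \<theta> \<partial>lborel"
  have [measurable]: "snd \<in> borel_measurable (borel :: ((real ^ 'n) \<times> real) measure)"
    by (simp add: borel_prod[symmetric])
  have [measurable]: "(\<lambda>(y, \<theta>). g (translated_point x y \<theta>)) \<in> borel_measurable (borel \<Otimes>\<^sub>M lborel)"
    unfolding split_beta'
    by (rule measurable_compose[OF translated_point_measurable g]) measurable
  have [measurable]: "?G \<in> borel_measurable borel"
    by (rule lborel.borel_measurable_nn_integral) measurable
  let ?I = "\<lambda>y'. \<integral>\<^sup>+s. g (y', s) * ?w s \<partial>lborel"
  have [measurable]: "(\<lambda>(y', s). g (y', s)) \<in> borel_measurable (borel \<Otimes>\<^sub>M lborel)"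
    using g by (simp add: split_beta' measurable_cong_sets[OF sets_pair_measure_cong[OF refl sets_lborel]] borel_prod)
  have [measurable]: "(\<lambda>s. g (y', s)) \<in> borel_measurable borel" for y'
    by (rule measurable_compose[OF _ g]) (simp add: borel_prod[symmetric])
  have [measurable]: "?I \<in> borel_measurable borel"
    by (rule lborel.borel_measurable_nn_integral) measurable
  have "(\<integral>\<^sup>+y. ?G y * ?w (snd y) \<partial>lborel) = (\<integral>\<^sup>+y'. \<integral>\<^sup>+s. ?G (y', s) * ?w s \<partial>lborel \<partial>lborel)"
    by (subst nn_integral_lborel_pair) auto
  also have "\<dots> = (\<integral>\<^sup>+y'. ennreal (angular_mass \<alpha>) * ?I (fst x + y') \<partial>lborel)"
  proof (rule nn_integral_cong)
    fix y' :: "real ^ 'n"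
    show "(\<integral>\<^sup>+s. ?G (y', s) * ?w s \<partial>lborel) = ennreal (angular_mass \<alpha>) * ?I (fst x + y')"
      using nn_integral_Bessel_translation[of "\<lambda>s. g (fst x + y', s)" "snd x" \<alpha>]
      by (simp add: translated_point_def nn_integral_sin_powr[OF \<alpha>])
  qed
  also have "\<dots> = ennreal (angular_mass \<alpha>) * (\<integral>\<^sup>+y'. ?I (fst x + y') \<partial>lborel)"
    by (rule nn_integral_cmult) measurable
  also have "(\<integral>\<^sup>+y'. ?I (fst x + y') \<partial>lborel) = (\<integral>\<^sup>+y'. ?I y' \<partial>distr lborel borel ((+) (fst x)))"
    by (rule nn_integral_distr[symmetric]) auto
  also have "\<dots> = (\<integral>\<^sup>+y'. ?I y' \<partial>lborel)"
    by (simp only: lborel_distr_plus)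
  also have "\<dots> = (\<integral>\<^sup>+y. g y * ?w (snd y) \<partial>lborel)"
    by (subst nn_integral_lborel_pair) auto
  finally show ?thesis
    by (simp add: nn_integral_weinstein mult.assoc)
qed

lemma nn_integral_weinstein_scale:
  fixes g :: "(real ^ 'n) \<times> real \<Rightarrow> ennreal"
  assumes g [measurable]: "g \<in> borel_measurable borel" and a: "0 < a"
  shows "(\<integral>\<^sup>+y. g (y /\<^sub>R a) \<partial>weinstein_measure \<alpha>) =
    ennreal (a powr (2 * \<alpha> + real CARD('n) + 2)) * (\<integral>\<^sup>+y. g y \<partial>weinstein_measure \<alpha>)"
proof -
  let ?w = "\<lambda>s. ennreal (s powr (2 * \<alpha> + 1)) * indicator {0<..} s"
  have [measurable]: "snd \<in> borel_measurable (borel :: ((real ^ 'n) \<times> real) measure)"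
    by (simp add: borel_prod[symmetric])
  have "(\<integral>\<^sup>+y. g (y /\<^sub>R a) * ?w (snd y) \<partial>lborel) =
      (\<integral>\<^sup>+y. g (y /\<^sub>R a) * ?w (snd y) \<partial>density (distr lborel borel (\<lambda>y. 0 + a *\<^sub>R y)) (\<lambda>_. ennreal (\<bar>a\<bar> ^ DIM((real ^ 'n) \<times> real))))"
    using a lborel_affine[of a "0 :: (real ^ 'n) \<times> real"] by simp
  also have "\<dots> = ennreal (a ^ (CARD('n) + 1)) * (\<integral>\<^sup>+y. g ((a *\<^sub>R y) /\<^sub>R a) * ?w (snd (a *\<^sub>R y)) \<partial>lborel)"
    using a by (simp add: nn_integral_density nn_integral_distr nn_integral_cmult)
  also have "(\<integral>\<^sup>+y. g ((a *\<^sub>R y) /\<^sub>R a) * ?w (snd (a *\<^sub>R y)) \<partial>lborel) =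
      (\<integral>\<^sup>+y. ennreal (a powr (2 * \<alpha> + 1)) * (g y * ?w (snd y)) \<partial>lborel)"
    using a
    by (intro nn_integral_cong)
       (auto simp: indicator_def powr_mult ennreal_mult zero_less_mult_iff mult_ac)
  also have "\<dots> = ennreal (a powr (2 * \<alpha> + 1)) * (\<integral>\<^sup>+y. g y * ?w (snd y) \<partial>lborel)"
    by (rule nn_integral_cmult) measurable
  also have "ennreal (a ^ (CARD('n) + 1)) * (ennreal (a powr (2 * \<alpha> + 1)) * (\<integral>\<^sup>+y. g y * ?w (snd y) \<partial>lborel)) =
      ennreal (a powr (2 * \<alpha> + real CARD('n) + 2)) * (\<integral>\<^sup>+y. g y * ?w (snd y) \<partial>lborel)"
  proof -
    have "a ^ (CARD('n) + 1) = a powr (real CARD('n) + 1)"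
      using a powr_realpow[of a "CARD('n) + 1"] by (simp add: algebra_simps)
    then have "a ^ (CARD('n) + 1) * a powr (2 * \<alpha> + 1) = a powr (2 * \<alpha> + real CARD('n) + 2)"
      by (simp only: powr_add[symmetric]) (simp add: algebra_simps)
    then show ?thesis
      using a by (simp only: mult.assoc[symmetric] ennreal_mult[symmetric] zero_le_power less_imp_le powr_ge_zero)
  qed
  finally show ?thesis
    by (simp add: nn_integral_weinstein mult.assoc)
qed

section \<open>The wavelet family\<close>

text \<open>
  The translated wavelet is dominated by the average of \<open>norm (\<phi> (u / a))\<close>. Of the dilation factor
  \<open>a powr - 2 k\<close> and the \<open>L2\<close> normalization \<open>a powr k\<close>, where \<open>k = \<alpha> + 1 + d / 2\<close>, there remains
  \<open>a powr - k\<close>. This is the factor in the supremum bound below; the Jacobian \<open>a powr 2 k\<close> of the Weinstein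
  measure turns it into \<open>a powr k\<close> in the \<open>L1\<close> bound.
\<close>

lemma norm_wavelet_family_le:
  fixes \<phi> :: "(real ^ 'n) \<times> real \<Rightarrow> complex"
  assumes \<phi> [measurable]: "\<phi> \<in> borel_measurable borel" and \<alpha>: "- 1 / 2 < \<alpha>" and a: "0 < a"
  shows "ennreal (norm (wavelet_family \<alpha> \<phi> a x y)) \<le>
    ennreal (1 / (angular_mass \<alpha> * a powr (\<alpha> + 1 + real CARD('n) / 2))) *
    (\<integral>\<^sup>+\<theta>. ennreal (norm (\<phi> (translated_point x y \<theta> /\<^sub>R a))) * ennreal (sin \<theta> powr (2 * \<alpha>)) * indicator {0<..<pi} \<theta> \<partial>lborel)"
proof -
  let ?k = "\<alpha> + 1 + real CARD('n) / 2"
  let ?F = "\<lambda>\<theta>. indicator {0<..<pi} \<theta> *\<^sub>R (dilation \<alpha> a \<phi> (translated_point x y \<theta>) * complex_of_real (sin \<theta> powr (2 * \<alpha>)))"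
  let ?h = "\<lambda>\<theta>. ennreal (norm (\<phi> (translated_point x y \<theta> /\<^sub>R a))) * ennreal (sin \<theta> powr (2 * \<alpha>)) * indicator {0<..<pi} \<theta>"
  have [measurable]: "translated_point x y \<in> measurable borel borel"
    by (rule translated_point_measurable) auto
  have m: "0 < angular_mass \<alpha>"
    using \<alpha> by (rule angular_mass_pos)
  have "ennreal (norm (LINT \<theta>|lborel. ?F \<theta>)) \<le> (\<integral>\<^sup>+\<theta>. norm (?F \<theta>) \<partial>lborel)"
  proof (cases "integrable lborel ?F")
    case True
    then show ?thesis by (rule integral_norm_bound_ennreal)
  qed (simp add: not_integrable_integral_eq)
  also have "\<dots> = (\<integral>\<^sup>+\<theta>. ennreal (a powr - (2 * ?k)) * ?h \<theta> \<partial>lborel)"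
    by (intro nn_integral_cong)
       (auto simp: dilation_def norm_mult indicator_def ennreal_mult algebra_simps)
  also have "\<dots> = ennreal (a powr - (2 * ?k)) * (\<integral>\<^sup>+\<theta>. ?h \<theta> \<partial>lborel)"
    by (rule nn_integral_cmult) measurable
  finally have F: "ennreal (norm (LINT \<theta>|lborel. ?F \<theta>)) \<le> ennreal (a powr - (2 * ?k)) * (\<integral>\<^sup>+\<theta>. ?h \<theta> \<partial>lborel)" .
  have "norm (wavelet_family \<alpha> \<phi> a x y) = a powr ?k / angular_mass \<alpha> * norm (LINT \<theta>|lborel. ?F \<theta>)"
    using m \<alpha>
    by (simp add: wavelet_family_def translation_def translated_point_def set_lebesgue_integral_def
        norm_mult norm_divide angular_mass_def Gamma_real_pos less_imp_le abs_of_pos)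
  then have "ennreal (norm (wavelet_family \<alpha> \<phi> a x y)) =
      ennreal (a powr ?k / angular_mass \<alpha>) * ennreal (norm (LINT \<theta>|lborel. ?F \<theta>))"
    using m by (subst ennreal_mult[symmetric]) simp_all
  also have "\<dots> \<le> ennreal (a powr ?k / angular_mass \<alpha>) * (ennreal (a powr - (2 * ?k)) * (\<integral>\<^sup>+\<theta>. ?h \<theta> \<partial>lborel))"
    by (intro mult_left_mono F) simp
  also have "\<dots> = ennreal (a powr ?k / angular_mass \<alpha> * a powr - (2 * ?k)) * (\<integral>\<^sup>+\<theta>. ?h \<theta> \<partial>lborel)"
  proof -
    have "ennreal u * (ennreal v * I) = ennreal (u * v) * I" if "0 \<le> u" "0 \<le> v" for u v I
      using that by (simp add: ennreal_mult mult.assoc)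
    from this[of "a powr ?k / angular_mass \<alpha>" "a powr - (2 * ?k)"] show ?thesis
      using m by simp
  qed
  also have "a powr ?k / angular_mass \<alpha> * a powr - (2 * ?k) = 1 / (angular_mass \<alpha> * a powr ?k)"
  proof -
    have "- (2 * ?k) = - ?k + - ?k" by simp
    then have "a powr - (2 * ?k) = a powr - ?k * a powr - ?k"
      by (simp only: powr_add)
    also have "\<dots> = 1 / a powr ?k * (1 / a powr ?k)"
      by (simp only: powr_minus_divide)
    finally show ?thesis
      using a by simp
  qed
  finally show ?thesis .
qed

lemma nn_integral_wavelet_family_le:
  fixes \<phi> :: "(real ^ 'n) \<times> real \<Rightarrow> complex"
  assumes \<phi> [measurable]: "\<phi> \<in> borel_measurable borel" and \<alpha>: "- 1 / 2 < \<alpha>" and a: "0 < a"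
  shows "(\<integral>\<^sup>+y. norm (wavelet_family \<alpha> \<phi> a x y) \<partial>weinstein_measure \<alpha>) \<le>
    ennreal (a powr (\<alpha> + 1 + real CARD('n) / 2)) * (\<integral>\<^sup>+y. norm (\<phi> y) \<partial>weinstein_measure \<alpha>)"
proof -
  let ?k = "\<alpha> + 1 + real CARD('n) / 2"
  let ?h = "\<lambda>y. \<integral>\<^sup>+\<theta>. ennreal (norm (\<phi> (translated_point x y \<theta> /\<^sub>R a))) * ennreal (sin \<theta> powr (2 * \<alpha>)) * indicator {0<..<pi} \<theta> \<partial>lborel"
  let ?c = "1 / (angular_mass \<alpha> * a powr ?k)"
  have m: "0 < angular_mass \<alpha>"
    using \<alpha> by (rule angular_mass_pos)
  have [measurable]: "(\<lambda>(y, \<theta>). translated_point x y \<theta>) \<in> measurable (borel \<Otimes>\<^sub>M lborel) borel"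
    unfolding split_beta' by (rule translated_point_measurable) measurable
  have "?h \<in> borel_measurable borel"
    by (rule lborel.borel_measurable_nn_integral) measurable
  then have [measurable]: "?h \<in> borel_measurable (weinstein_measure \<alpha>)"
    by (rule borel_measurable_weinstein)
  have "(\<integral>\<^sup>+y. norm (wavelet_family \<alpha> \<phi> a x y) \<partial>weinstein_measure \<alpha>) \<le>
      (\<integral>\<^sup>+y. ennreal ?c * ?h y \<partial>weinstein_measure \<alpha>)"
    by (intro nn_integral_mono norm_wavelet_family_le \<phi> \<alpha> a)
  also have "\<dots> = ennreal ?c * (\<integral>\<^sup>+y. ?h y \<partial>weinstein_measure \<alpha>)"
    by (rule nn_integral_cmult) measurable
  also have "(\<integral>\<^sup>+y. ?h y \<partial>weinstein_measure \<alpha>) =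
      ennreal (angular_mass \<alpha>) * (\<integral>\<^sup>+y. norm (\<phi> (y /\<^sub>R a)) \<partial>weinstein_measure \<alpha>)"
    using \<alpha> by (intro nn_integral_translated_point[of "\<lambda>u. ennreal (norm (\<phi> (u /\<^sub>R a)))"]) measurable
  also have "(\<integral>\<^sup>+y. norm (\<phi> (y /\<^sub>R a)) \<partial>weinstein_measure \<alpha>) =
      ennreal (a powr (2 * \<alpha> + real CARD('n) + 2)) * (\<integral>\<^sup>+y. norm (\<phi> y) \<partial>weinstein_measure \<alpha>)"
    using a by (intro nn_integral_weinstein_scale) measurable
  also have "ennreal ?c * (ennreal (angular_mass \<alpha>) * (ennreal (a powr (2 * \<alpha> + real CARD('n) + 2)) *
        (\<integral>\<^sup>+y. norm (\<phi> y) \<partial>weinstein_measure \<alpha>))) =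
      ennreal (?c * angular_mass \<alpha> * a powr (2 * \<alpha> + real CARD('n) + 2)) *
        (\<integral>\<^sup>+y. norm (\<phi> y) \<partial>weinstein_measure \<alpha>)"
  proof -
    have "ennreal u * (ennreal v * (ennreal w * I)) = ennreal (u * v * w) * I"
      if "0 \<le> u" "0 \<le> v" "0 \<le> w" for u v w I
      using that by (simp add: ennreal_mult mult.assoc)
    from this[of ?c "angular_mass \<alpha>" "a powr (2 * \<alpha> + real CARD('n) + 2)"] show ?thesis
      using m by simp
  qed
  also have "?c * angular_mass \<alpha> * a powr (2 * \<alpha> + real CARD('n) + 2) = a powr ?k"
  proof -
    have "2 * \<alpha> + real CARD('n) + 2 = ?k + ?k" by simp
    then have "a powr (2 * \<alpha> + real CARD('n) + 2) = a powr ?k * a powr ?k"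
      by (simp only: powr_add)
    then show ?thesis using m a by simp
  qed
  finally show ?thesis .
qed

text \<open>
  The set where \<open>norm (\<phi> (u / a))\<close> exceeds \<open>N\<close> is null, hence by translation invariance almost every
  \<open>y\<close> is such that \<open>translated_point x y \<theta>\<close> meets this set for almost no \<open>\<theta>\<close>.
\<close>

lemma AE_wavelet_family_le:
  fixes \<phi> :: "(real ^ 'n) \<times> real \<Rightarrow> complex"
  assumes \<phi> [measurable]: "\<phi> \<in> borel_measurable borel" and \<alpha>: "- 1 / 2 < \<alpha>" and a: "0 < a"
    and N: "AE y in weinstein_measure \<alpha>. norm (\<phi> y) \<le> N" "0 \<le> N"
  shows "AE y in weinstein_measure \<alpha>.
    norm (wavelet_family \<alpha> \<phi> a x y) \<le> N / a powr (\<alpha> + 1 + real CARD('n) / 2)"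
proof -
  let ?k = "\<alpha> + 1 + real CARD('n) / 2"
  let ?c = "1 / (angular_mass \<alpha> * a powr ?k)"
  let ?bad = "\<lambda>u. indicator {u. N < norm (\<phi> u)} u :: ennreal"
  let ?sin = "\<lambda>\<theta>. ennreal (sin \<theta> powr (2 * \<alpha>)) * indicator {0<..<pi} \<theta>"
  let ?h = "\<lambda>y. \<integral>\<^sup>+\<theta>. ?bad (translated_point x y \<theta> /\<^sub>R a) * ennreal (sin \<theta> powr (2 * \<alpha>)) * indicator {0<..<pi} \<theta> \<partial>lborel"
  have m: "0 < angular_mass \<alpha>"
    using \<alpha> by (rule angular_mass_pos)
  have bad [measurable]: "?bad \<in> borel_measurable borel"
    by measurable
  have [measurable]: "(\<lambda>(y, \<theta>). translated_point x y \<theta>) \<in> measurable (borel \<Otimes>\<^sub>M lborel) borel"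
    unfolding split_beta' by (rule translated_point_measurable) measurable
  have point [measurable]: "translated_point x y \<in> measurable borel borel" for y
    by (rule translated_point_measurable) auto
  have "?h \<in> borel_measurable borel"
    by (rule lborel.borel_measurable_nn_integral) measurable
  then have [measurable]: "?h \<in> borel_measurable (weinstein_measure \<alpha>)"
    by (rule borel_measurable_weinstein)
  have "(\<integral>\<^sup>+y. ?h y \<partial>weinstein_measure \<alpha>) =
      ennreal (angular_mass \<alpha>) * (\<integral>\<^sup>+y. ?bad (y /\<^sub>R a) \<partial>weinstein_measure \<alpha>)"
    using \<alpha> by (intro nn_integral_translated_point[of "\<lambda>u. ?bad (u /\<^sub>R a)"]) measurable
  also have "(\<integral>\<^sup>+y. ?bad (y /\<^sub>R a) \<partial>weinstein_measure \<alpha>) =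
      ennreal (a powr (2 * \<alpha> + real CARD('n) + 2)) * (\<integral>\<^sup>+y. ?bad y \<partial>weinstein_measure \<alpha>)"
    using a by (intro nn_integral_weinstein_scale) measurable
  also have "(\<integral>\<^sup>+y. ?bad y \<partial>weinstein_measure \<alpha>) = nn_integral (weinstein_measure \<alpha>) (\<lambda>y :: (real ^ 'n) \<times> real. 0)"
  proof (rule nn_integral_cong_AE)
    show "AE y in weinstein_measure \<alpha>. ?bad y = 0"
      using N(1) by eventually_elim simp
  qed
  finally have "(\<integral>\<^sup>+y. ?h y \<partial>weinstein_measure \<alpha>) = 0"
    by simp
  then have "AE y in weinstein_measure \<alpha>. ?h y = 0"
    by (subst (asm) nn_integral_0_iff_AE) measurable
  then show ?thesis
  proof eventually_elim
    case (elim y)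
    note [measurable] = point[of y]
    have "(\<integral>\<^sup>+\<theta>. ennreal (norm (\<phi> (translated_point x y \<theta> /\<^sub>R a))) * ennreal (sin \<theta> powr (2 * \<alpha>)) * indicator {0<..<pi} \<theta> \<partial>lborel)
        \<le> (\<integral>\<^sup>+\<theta>. ennreal N * ?sin \<theta>
            + \<infinity> * (?bad (translated_point x y \<theta> /\<^sub>R a) * ennreal (sin \<theta> powr (2 * \<alpha>)) * indicator {0<..<pi} \<theta>) \<partial>lborel)"
    proof (rule nn_integral_mono)
      fix \<theta>
      let ?p = "translated_point x y \<theta> /\<^sub>R a"
      have "ennreal (norm (\<phi> ?p)) \<le> ennreal N + \<infinity> * ?bad ?p"
        by (cases "norm (\<phi> ?p) \<le> N") (auto simp: indicator_def intro: ennreal_leI)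
      then have "ennreal (norm (\<phi> ?p)) * ?sin \<theta> \<le> (ennreal N + \<infinity> * ?bad ?p) * ?sin \<theta>"
        by (rule mult_right_mono) simp
      then show "ennreal (norm (\<phi> ?p)) * ennreal (sin \<theta> powr (2 * \<alpha>)) * indicator {0<..<pi} \<theta> \<le>
          ennreal N * ?sin \<theta> + \<infinity> * (?bad ?p * ennreal (sin \<theta> powr (2 * \<alpha>)) * indicator {0<..<pi} \<theta>)"
        by (simp only: distrib_right mult.assoc)
    qed
    also have "\<dots> = ennreal N * (\<integral>\<^sup>+\<theta>. ?sin \<theta> \<partial>lborel) + \<infinity> * ?h y"
    proof -
      have split: "(\<integral>\<^sup>+\<theta>. ennreal N * s \<theta> + \<infinity> * b \<theta> \<partial>lborel) =
          ennreal N * (\<integral>\<^sup>+\<theta>. s \<theta> \<partial>lborel) + \<infinity> * (\<integral>\<^sup>+\<theta>. b \<theta> \<partial>lborel)"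
        if "s \<in> borel_measurable lborel" "b \<in> borel_measurable lborel" for s b :: "real \<Rightarrow> ennreal"
        using that by (simp add: nn_integral_add nn_integral_cmult)
      show ?thesis
        by (rule split) measurable
    qed
    also have "\<dots> = ennreal N * ennreal (angular_mass \<alpha>)"
      using elim by (simp add: nn_integral_sin_powr[OF \<alpha>])
    finally have "ennreal (norm (wavelet_family \<alpha> \<phi> a x y)) \<le> ennreal ?c * (ennreal N * ennreal (angular_mass \<alpha>))"
      using norm_wavelet_family_le[OF \<phi> \<alpha> a, of x y] by (meson mult_left_mono order_trans zero_le)
    also have "\<dots> = ennreal (N / a powr ?k)"
      using m N(2) by (simp flip: ennreal_mult)
    finally show ?case
      using N(2) by simp
  qed
qed

text \<open>
  For interior angles the translated point stays in the half-space, so the values of \<open>\<phi>\<close> elsewhere do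
  not matter.
\<close>

lemma wavelet_family_cong:
  assumes "a > 0" "x \<in> half_space" "y \<in> half_space"
    and "\<And>u. u \<in> half_space \<Longrightarrow> \<phi> u = \<phi>' u"
  shows "wavelet_family \<alpha> \<phi> a x y = wavelet_family \<alpha> \<phi>' a x y"
proof -
  have "dilation \<alpha> a \<phi> (translated_point x y \<theta>) = dilation \<alpha> a \<phi>' (translated_point x y \<theta>)"
    if "\<theta> \<in> {0<..<pi}" for \<theta>
  proof -
    have "translated_point x y \<theta> /\<^sub>R a \<in> half_space"
      using translated_point_half_space[OF assms(2,3) that] assms(1) by (simp add: half_space_def)
    then show ?thesis
      by (simp add: dilation_def assms(4))
  qed
  then show ?thesis
    unfolding wavelet_family_def translation_def translated_point_def[symmetric]
    by (intro arg_cong2[where f = "(*)"] refl set_lebesgue_integral_cong) auto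
qed

lemma space_scale_measure_X: "space (scale_measure_X \<alpha>) = {0<..} \<times> half_space"
  by (simp add: scale_measure_X_def space_pair_measure space_weinstein_measure space_restrict_space)

lemma measurable_scale_measure_X:
  "(\<lambda>z. fst z) \<in> measurable (scale_measure_X \<alpha>) borel"
  "(\<lambda>z. snd z) \<in> measurable (scale_measure_X \<alpha>) borel"
proof -
  have sets: "sets (scale_measure_X \<alpha>) = sets (restrict_space lborel {0<..} \<Otimes>\<^sub>M weinstein_measure \<alpha>)"
    by (simp add: scale_measure_X_def)
  have 1: "(\<lambda>x. x) \<in> measurable (restrict_space lborel {0<..}) (borel :: real measure)"
    by (rule measurable_restrict_space1) simp
  show "(\<lambda>z. fst z) \<in> measurable (scale_measure_X \<alpha>) borel"
    unfolding measurable_cong_sets[OF sets refl] by (rule measurable_compose[OF measurable_fst 1])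
  show "(\<lambda>z. snd z) \<in> measurable (scale_measure_X \<alpha>) borel"
    unfolding measurable_cong_sets[OF sets refl]
    by (rule measurable_compose[OF measurable_snd measurable_weinstein_id])
qed

lemma sigma_finite_weinstein_measure: "sigma_finite_measure (weinstein_measure \<alpha> :: ((real ^ 'n) \<times> real) measure)"
proof -
  let ?R = "restrict_space lborel half_space :: ((real ^ 'n) \<times> real) measure"
  have R: "sigma_finite_measure ?R"
    by (rule sigma_finite_measure_restrict_space) (auto simp: lborel.sigma_finite_measure_axioms)
  have [measurable]: "snd \<in> borel_measurable (borel :: ((real ^ 'n) \<times> real) measure)"
    by (simp add: borel_prod[symmetric])
  have "(\<lambda>x :: (real ^ 'n) \<times> real. ennreal (snd x powr (2 * \<alpha> + 1) /
        ((2 * pi) ^ CARD('n) * 2 powr (2 * \<alpha>) * (Gamma (\<alpha> + 1))\<^sup>2))) \<in> borel_measurable lborel"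
    by measurable
  then have "(\<lambda>x :: (real ^ 'n) \<times> real. ennreal (snd x powr (2 * \<alpha> + 1) /
        ((2 * pi) ^ CARD('n) * 2 powr (2 * \<alpha>) * (Gamma (\<alpha> + 1))\<^sup>2))) \<in> borel_measurable ?R"
    by (rule measurable_restrict_space1)
  from sigma_finite_measure.sigma_finite_iff_density_finite[OF R this] show ?thesis
    unfolding weinstein_measure_def by simp
qed

lemma sigma_finite_scale_measure_X:
  "sigma_finite_measure (scale_measure_X \<alpha> :: (real \<times> ((real ^ 'n) \<times> real)) measure)"
proof -
  let ?R = "restrict_space lborel {0<..} :: real measure"
  interpret R: sigma_finite_measure ?R
    by (rule sigma_finite_measure_restrict_space) (auto simp: lborel.sigma_finite_measure_axioms)
  interpret W: sigma_finite_measure "weinstein_measure \<alpha> :: ((real ^ 'n) \<times> real) measure"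
    by (rule sigma_finite_weinstein_measure)
  interpret RW: pair_sigma_finite ?R "weinstein_measure \<alpha> :: ((real ^ 'n) \<times> real) measure" ..
  have "(\<lambda>x. x) \<in> measurable ?R borel"
    by (rule measurable_restrict_space1) simp
  then have [measurable]: "fst \<in> borel_measurable (?R \<Otimes>\<^sub>M (weinstein_measure \<alpha> :: ((real ^ 'n) \<times> real) measure))"
    by (rule measurable_compose[OF measurable_fst])
  show ?thesis
    unfolding scale_measure_X_def
    by (subst RW.P.sigma_finite_iff_density_finite) (auto simp: split_beta')
qed

lemma wavelet_family_measurable:
  fixes \<phi> :: "(real ^ 'n) \<times> real \<Rightarrow> complex"
  assumes [measurable]: "\<phi> \<in> borel_measurable borel"
  shows "(\<lambda>(z, y). wavelet_family \<alpha> \<phi> (fst z) (snd z) y)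
    \<in> borel_measurable (scale_measure_X \<alpha> \<Otimes>\<^sub>M weinstein_measure \<alpha>)"
proof -
  let ?N = "scale_measure_X \<alpha> \<Otimes>\<^sub>M weinstein_measure \<alpha> :: ((real \<times> ((real ^ 'n) \<times> real)) \<times> ((real ^ 'n) \<times> real)) measure"
  have [measurable]: "(\<lambda>u. fst (fst u)) \<in> borel_measurable ?N" "(\<lambda>u. snd (fst u)) \<in> borel_measurable ?N"
      "(\<lambda>u. snd u) \<in> borel_measurable ?N"
    using measurable_compose[OF measurable_fst measurable_scale_measure_X(1)]
      measurable_compose[OF measurable_fst measurable_scale_measure_X(2)]
      measurable_compose[OF measurable_snd measurable_weinstein_id] by auto
  have [measurable]: "(\<lambda>(u, \<theta>). translated_point (snd (fst u)) (snd u) \<theta>) \<in> measurable (?N \<Otimes>\<^sub>M lborel) borel"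
    unfolding split_beta' by (rule translated_point_measurable) measurable
  have "(\<lambda>u. LINT \<theta>|lborel. indicator {0<..<pi} \<theta> *\<^sub>R
      (complex_of_real (fst (fst u) powr - (2 * \<alpha> + real CARD('n) + 2)) *
        \<phi> (translated_point (snd (fst u)) (snd u) \<theta> /\<^sub>R fst (fst u)) * complex_of_real (sin \<theta> powr (2 * \<alpha>))))
     \<in> borel_measurable ?N"
    by (rule lborel.borel_measurable_lebesgue_integral) measurable
  then show ?thesis
    unfolding wavelet_family_def translation_def dilation_def set_lebesgue_integral_def
      translated_point_def[symmetric] split_beta'
    by measurable
qed

text \<open>
  Windows are only given on the half-space, so they are extended by zero to Borel functions on the
  whole space before the estimates are applied; this does not change the wavelets on the half-space.
\<close>

lemma wavelet_family_window:
  fixes \<phi> :: "(real ^ 'n) \<times> real \<Rightarrow> complex"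
  assumes \<alpha>: "- 1 / 2 < \<alpha>"
    and \<phi>: "\<phi> \<in> Lp_functions (weinstein_measure \<alpha>) 1 \<inter> Lp_functions (weinstein_measure \<alpha>) \<infinity>"
  shows "(\<lambda>(z, y). wavelet_family \<alpha> \<phi> (fst z) (snd z) y)
      \<in> borel_measurable (scale_measure_X \<alpha> \<Otimes>\<^sub>M weinstein_measure \<alpha>)" (is ?measurable)
    and "0 < a \<Longrightarrow> x \<in> half_space \<Longrightarrow>
      (\<integral>\<^sup>+y. norm (wavelet_family \<alpha> \<phi> a x y) \<partial>weinstein_measure \<alpha>) \<le>
        ennreal (a powr (\<alpha> + 1 + real CARD('n) / 2) * Lp_norm (weinstein_measure \<alpha>) 1 \<phi>)"
    and "0 < a \<Longrightarrow> x \<in> half_space \<Longrightarrow>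
      AE y in weinstein_measure \<alpha>. norm (wavelet_family \<alpha> \<phi> a x y) \<le>
        Lp_norm (weinstein_measure \<alpha>) \<infinity> \<phi> / a powr (\<alpha> + 1 + real CARD('n) / 2)"
proof -
  let ?W = "weinstein_measure \<alpha> :: ((real ^ 'n) \<times> real) measure"
  define \<phi>\<^sub>0 where "\<phi>\<^sub>0 u = indicator half_space u *\<^sub>R \<phi> u" for u
  have eq: "\<phi> u = \<phi>\<^sub>0 u" if "u \<in> half_space" for u
    using that by (simp add: \<phi>\<^sub>0_def)
  have fam: "wavelet_family \<alpha> \<phi> a x y = wavelet_family \<alpha> \<phi>\<^sub>0 a x y"
    if "0 < a" "x \<in> half_space" "y \<in> half_space" for a x y
    using that eq by (rule wavelet_family_cong)
  have "\<phi> \<in> borel_measurable ?W"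
    using \<phi> by (blast dest: Lp_functions_measurable)
  then have "\<phi> \<in> borel_measurable (restrict_space borel half_space)"
    by (simp only: measurable_cong_sets[OF sets_weinstein_measure refl])
  then have borel: "\<phi>\<^sub>0 \<in> borel_measurable borel"
    unfolding \<phi>\<^sub>0_def by (subst (asm) borel_measurable_restrict_space_iff) auto
  have L1: "(\<integral>\<^sup>+y. norm (\<phi>\<^sub>0 y) \<partial>?W) = ennreal (Lp_norm ?W 1 \<phi>)"
  proof -
    have "(\<integral>\<^sup>+y. norm (\<phi>\<^sub>0 y) \<partial>?W) = (\<integral>\<^sup>+y. norm (\<phi> y) \<partial>?W)"
      by (intro nn_integral_cong) (simp add: space_weinstein_measure eq)
    also have "\<dots> = ennreal (Lp_norm ?W 1 \<phi>)"
      using \<phi> unfolding Lp_norm_1 by (intro nn_integral_eq_integral) (auto simp: Lp_functions_1_iff)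
    finally show ?thesis .
  qed
  have Linf: "AE y in ?W. norm (\<phi>\<^sub>0 y) \<le> Lp_norm ?W \<infinity> \<phi>"
    using Lp_norm_infinity_AE[of \<phi> ?W] \<phi> AE_space[of ?W]
    by (auto simp: space_weinstein_measure eq[symmetric] elim: eventually_elim2)
  show ?measurable
  proof (subst measurable_cong)
    show "(\<lambda>(z, y). wavelet_family \<alpha> \<phi>\<^sub>0 (fst z) (snd z) y)
        \<in> borel_measurable (scale_measure_X \<alpha> \<Otimes>\<^sub>M ?W)"
      using borel by (rule wavelet_family_measurable)
  qed (auto simp: space_pair_measure space_scale_measure_X space_weinstein_measure fam)
  assume a: "0 < a" and x: "x \<in> half_space"
  have "(\<integral>\<^sup>+y. norm (wavelet_family \<alpha> \<phi> a x y) \<partial>?W) = (\<integral>\<^sup>+y. norm (wavelet_family \<alpha> \<phi>\<^sub>0 a x y) \<partial>?W)"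
    using a x by (intro nn_integral_cong) (simp add: space_weinstein_measure fam)
  also have "\<dots> \<le> ennreal (a powr (\<alpha> + 1 + real CARD('n) / 2)) * ennreal (Lp_norm ?W 1 \<phi>)"
    using nn_integral_wavelet_family_le[OF borel \<alpha> a] by (simp only: L1)
  finally show "(\<integral>\<^sup>+y. norm (wavelet_family \<alpha> \<phi> a x y) \<partial>?W) \<le>
        ennreal (a powr (\<alpha> + 1 + real CARD('n) / 2) * Lp_norm ?W 1 \<phi>)"
    by (simp add: ennreal_mult Lp_norm_nonneg)
  show "AE y in ?W. norm (wavelet_family \<alpha> \<phi> a x y) \<le> Lp_norm ?W \<infinity> \<phi> / a powr (\<alpha> + 1 + real CARD('n) / 2)"
    using AE_wavelet_family_le[OF borel \<alpha> a Linf Lp_norm_nonneg, of x] AE_space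
    by eventually_elim (simp add: space_weinstein_measure fam a x)
qed

text \<open>
  Both norms vanish exactly for functions that are zero almost everywhere. At the endpoint \<open>p = \<infinity>\<close> this
  reconciles the factor \<open>0 powr 0 = 0\<close> with the estimate.
\<close>

lemma Lp_norm_infinity_eq_0_iff:
  assumes f: "f \<in> Lp_functions M 1 \<inter> Lp_functions M \<infinity>"
  shows "Lp_norm M \<infinity> f = 0 \<longleftrightarrow> Lp_norm M 1 f = 0"
proof -
  have int: "integrable M f" and meas: "f \<in> borel_measurable M"
    using f by (auto simp: Lp_functions_1_iff)
  have "Lp_norm M 1 f = 0 \<longleftrightarrow> (AE x in M. f x = 0)"
    unfolding Lp_norm_1 using int by (subst integral_nonneg_eq_0_iff_AE) auto
  also have "\<dots> \<longleftrightarrow> Lp_norm M \<infinity> f = 0"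
  proof
    assume "AE x in M. f x = 0"
    then have "AE x in M. norm (f x) \<le> 0" by simp
    from Lp_norm_infinity_le[OF meas this] Lp_norm_nonneg[of M \<infinity> f] show "Lp_norm M \<infinity> f = 0"
      by simp
  next
    assume "Lp_norm M \<infinity> f = 0"
    with Lp_norm_infinity_AE[of f M] f show "AE x in M. f x = 0"
      by simp
  qed
  finally show ?thesis ..
qed

section \<open>Boundedness of the localization operator\<close>

theorem theorem3p5:
  fixes \<alpha> :: real
    and \<phi> \<psi> :: "(real ^ 'n) \<times> real \<Rightarrow> complex"
    and \<sigma> :: "real \<times> ((real ^ 'n) \<times> real) \<Rightarrow> complex"
    and p q :: ennreal
  assumes "\<alpha> > - 1 / 2"
    and "\<phi> \<in> Lp_functions (weinstein_measure \<alpha>) 1 \<inter> Lp_functions (weinstein_measure \<alpha>) \<infinity>"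
    and "\<psi> \<in> Lp_functions (weinstein_measure \<alpha>) 1 \<inter> Lp_functions (weinstein_measure \<alpha>) \<infinity>"
    and "\<sigma> \<in> Lp_functions (scale_measure_X \<alpha>) 1"
    and "1 \<le> p"
    and "1 / p + 1 / q = 1"
  shows "\<exists>T. is_localization_operator \<alpha> \<phi> \<psi> \<sigma> p T \<and>
             (\<forall>S. is_localization_operator \<alpha> \<phi> \<psi> \<sigma> p S \<longrightarrow> S = T) \<and>
             operator_norm_Lp (weinstein_measure \<alpha>) p T
               \<le> Lp_norm (weinstein_measure \<alpha>) 1 \<phi> powr enn2real (1 / q) *
                 Lp_norm (weinstein_measure \<alpha>) 1 \<psi> powr enn2real (1 / p) *
                 Lp_norm (weinstein_measure \<alpha>) \<infinity> \<phi> powr enn2real (1 / p) *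
                 Lp_norm (weinstein_measure \<alpha>) \<infinity> \<psi> powr enn2real (1 / q) *
                 Lp_norm (scale_measure_X \<alpha>) 1 \<sigma>"
proof -
  let ?W = "weinstein_measure \<alpha> :: ((real ^ 'n) \<times> real) measure"
  let ?X = "scale_measure_X \<alpha> :: (real \<times> ((real ^ 'n) \<times> real)) measure"
  let ?P = "\<lambda>z. wavelet_family \<alpha> \<phi> (fst z) (snd z)" and ?Q = "\<lambda>z. wavelet_family \<alpha> \<psi> (fst z) (snd z)"
  let ?c = "\<lambda>z :: real \<times> ((real ^ 'n) \<times> real). fst z powr (\<alpha> + 1 + real CARD('n) / 2)"
  have spaceX: "0 < fst z \<and> snd z \<in> half_space" if "z \<in> space ?X" for z
    using that by (auto simp: space_scale_measure_X)
  note \<phi> = wavelet_family_window[OF assms(1,2)] and \<psi> = wavelet_family_window[OF assms(1,3)]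
  interpret balanced_kernels ?X ?W ?P ?Q ?c \<sigma>
    "Lp_norm ?W 1 \<phi>" "Lp_norm ?W \<infinity> \<phi>" "Lp_norm ?W 1 \<psi>" "Lp_norm ?W \<infinity> \<psi>"
  proof (intro balanced_kernels.intro balanced_kernels_axioms.intro)
    show "?c \<in> borel_measurable ?X"
      using measurable_scale_measure_X(1) by measurable
    show "integrable ?X \<sigma>"
      using assms(4) by (simp only: Lp_functions_1_iff)
    show "case_prod ?P \<in> borel_measurable (?X \<Otimes>\<^sub>M ?W)" "case_prod ?Q \<in> borel_measurable (?X \<Otimes>\<^sub>M ?W)"
      by (rule \<phi>(1), rule \<psi>(1))
    fix z assume "z \<in> space ?X"
    then have z: "0 < fst z" "snd z \<in> half_space"
      using spaceX by blast+
    show "0 < ?c z" using z(1) by simp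
    show "(\<integral>\<^sup>+y. norm (?P z y) \<partial>?W) \<le> ennreal (?c z * Lp_norm ?W 1 \<phi>)"
      and "(\<integral>\<^sup>+y. norm (?Q z y) \<partial>?W) \<le> ennreal (?c z * Lp_norm ?W 1 \<psi>)"
      by (rule \<phi>(2)[OF z], rule \<psi>(2)[OF z])
    show "AE y in ?W. norm (?P z y) \<le> Lp_norm ?W \<infinity> \<phi> / ?c z"
      and "AE y in ?W. norm (?Q z y) \<le> Lp_norm ?W \<infinity> \<psi> / ?c z"
      by (rule \<phi>(3)[OF z], rule \<psi>(3)[OF z])
  qed (rule sigma_finite_scale_measure_X sigma_finite_weinstein_measure Lp_norm_nonneg)+
  have coefficient: "coefficient f z = wavelet_transform \<alpha> \<phi> f (fst z) (snd z)" for f z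
    by (simp add: coefficient_def wavelet_transform_def)
  have integrand: "localization_integrand \<alpha> \<phi> \<psi> \<sigma> f y = (\<lambda>z. \<sigma> z * coefficient f z * ?Q z y)" for f y
    by (auto simp: localization_integrand_def coefficient fun_eq_iff)
  have localization: "localization \<alpha> \<phi> \<psi> \<sigma> f = superposition f" for f
    by (simp add: localization_def superposition_def integrand fun_eq_iff)
  have converges: "localization_converges \<alpha> \<phi> \<psi> \<sigma> f" if f: "f \<in> Lp_functions ?W p" for f
    unfolding localization_converges_def integrand
  proof (intro conjI allI impI ballI)
    show "AE y in ?W. integrable ?X (\<lambda>z. \<sigma> z * coefficient f z * ?Q z y)"
      using f assms(5) by (rule superposition_integrable)
    show "integrable ?W (\<lambda>y. f y * cnj (wavelet_family \<alpha> \<phi> a x y))"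
      if "0 < a" "x \<in> half_space" for a x
      using coefficient_integrable[OF f assms(5), of "(a, x)"] that by (simp add: space_scale_measure_X)
  qed
  obtain T where T: "bounded_operator_Lp ?W p T"
      "\<And>f. f \<in> Lp_functions ?W p \<Longrightarrow> T (Lp_class ?W p f) = Lp_class ?W p (superposition f)"
      "operator_norm_Lp ?W p T \<le> schur_bound p"
    using superposition_operator[OF assms(5)] by blast
  have operator: "is_localization_operator \<alpha> \<phi> \<psi> \<sigma> p T"
    using T converges by (simp add: is_localization_operator_def localization)
  have unique: "\<forall>S. is_localization_operator \<alpha> \<phi> \<psi> \<sigma> p S \<longrightarrow> S = T"
  proof (intro allI impI)
    fix S assume S: "is_localization_operator \<alpha> \<phi> \<psi> \<sigma> p S"
    show "S = T"
    proof (rule bounded_operator_Lp_eqI)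
      show "bounded_operator_Lp ?W p S"
        using S by (simp add: is_localization_operator_def)
      show "S (Lp_class ?W p f) = T (Lp_class ?W p f)" if "f \<in> Lp_functions ?W p" for f
        using S that T(2)[OF that] by (simp add: is_localization_operator_def localization)
    qed (rule T(1))
  qed
  have bound: "schur_bound p = Lp_norm ?W 1 \<phi> powr enn2real (1 / q) * Lp_norm ?W 1 \<psi> powr enn2real (1 / p) *
       Lp_norm ?W \<infinity> \<phi> powr enn2real (1 / p) * Lp_norm ?W \<infinity> \<psi> powr enn2real (1 / q) * Lp_norm ?X 1 \<sigma>"
  proof -
    have symbol_mass: "symbol_mass = Lp_norm ?X 1 \<sigma>"
      by (simp add: symbol_mass_def Lp_norm_1)
    have "1 / p \<le> 1 / p + 1 / q" "1 / q \<le> 1 / p + 1 / q"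
      by simp_all
    then have "1 / p < top" "1 / q < top"
      unfolding assms(6) by (auto intro: order_le_less_trans)
    then have "enn2real (1 / p + 1 / q) = enn2real (1 / p) + enn2real (1 / q)"
      by (rule enn2real_plus)
    then have sum: "enn2real (1 / p) + enn2real (1 / q) = 1"
      by (simp add: assms(6))
    show ?thesis
    proof (cases "p = \<infinity>")
      case True
      then have "enn2real (1 / p) = 0" by simp
      with sum have "enn2real (1 / q) = 1" by simp
      \<comment> \<open>At this endpoint the bound contains the factors \<open>\<parallel>\<phi>\<parallel>\<^sub>\<infinity> powr 0\<close> and \<open>\<parallel>\<psi>\<parallel>\<^sub>1 powr 0\<close>, which are
         \<open>0\<close> rather than \<open>1\<close> for a vanishing window; but then \<open>\<parallel>\<phi>\<parallel>\<^sub>1\<close> or \<open>\<parallel>\<psi>\<parallel>\<^sub>\<infinity>\<close> vanishes too.\<close>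
      have "schur_bound p = Lp_norm ?W 1 \<phi> * Lp_norm ?W \<infinity> \<psi> * Lp_norm ?X 1 \<sigma>"
        using True by (simp only: schur_bound_def refl if_True row_mass_def symbol_mass)
      then show ?thesis
        unfolding \<open>enn2real (1 / p) = 0\<close> \<open>enn2real (1 / q) = 1\<close>
        using Lp_norm_infinity_eq_0_iff[OF assms(2)] Lp_norm_infinity_eq_0_iff[OF assms(3)]
        by (auto simp: Lp_norm_nonneg)
    next
      case False
      then obtain r where r: "0 \<le> r" "p = ennreal r"
        by (cases p) auto
      then have "1 \<le> r" using assms(5) by simp
      then have s: "enn2real (1 / p) = 1 / enn2real p"
        using r by (simp add: divide_ennreal flip: ennreal_1)
      then have t: "1 - 1 / enn2real p = enn2real (1 / q)"
        using sum by simp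
      have "schur_bound p = row_mass powr enn2real (1 / q) * column_mass powr enn2real (1 / p)"
        using False by (simp only: schur_bound_def if_False t s)
      also have "\<dots> = Lp_norm ?W 1 \<phi> powr enn2real (1 / q) * Lp_norm ?W 1 \<psi> powr enn2real (1 / p) *
          Lp_norm ?W \<infinity> \<phi> powr enn2real (1 / p) * Lp_norm ?W \<infinity> \<psi> powr enn2real (1 / q) *
          (symbol_mass powr enn2real (1 / p) * symbol_mass powr enn2real (1 / q))"
        by (simp only: row_mass_def column_mass_def powr_mult mult_ac)
      also have "symbol_mass powr enn2real (1 / p) * symbol_mass powr enn2real (1 / q) = symbol_mass"
        using symbol_mass_nonneg by (simp only: powr_add[symmetric] sum powr_one)
      finally show ?thesis
        by (simp only: symbol_mass)
    qed
  qed
  show ?thesis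
    using operator unique T(3)[unfolded bound] by (intro exI conjI)
qed

end
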